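(* Let $M$ be a pre-ordered commutative monoid, $G$ a group, and $A\to\operatorname{Aut}(G)$ a group homomorphism. Let $\phi:M\to2^G$ be a filter such that every $\phi_s$ is $A$-invariant. Then the function $\Delta\phi:M\to2^A$ given by $$\Delta_s\phi=\{a\in A:\ \forall t\in M,\ [\phi_t,a]\leq\phi_{t+s}\}$$ is a filter (on the group $A$), and there is a natural graded Lie ring homomorphism from $L_*(\Delta\phi)$ into the derivation Lie ring $\operatorname{Der}(L_*(\phi))$, sending the class of $a\in\Delta_s\phi$ ($s\neq0$) to the derivation $D_a$ determined by $\bar xD_a=\overline{[x,a]}\in L_{s+u}(\phi)$ for $x\in\phi_u$, $u\neq0$.
   Context: Monoid: $M=\langle M,+,0,\prec\rangle$ is a commutative monoid with a pre-order $\prec$ such that $0\prec s$ for all $s\in M$, and $s\prec t$, $u\prec v$ imply $s+u\prec t+v$. Commutators in a group are $[g,h]=g^{-1}h^{-1}gh$ and $[X,Y]=\langle[x,y]:x\in X,y\in Y\rangle$. $A$ acts on $G$ on the right via $A\to\operatorname{Aut}(G)$, written $x\mapsto x^a$; for $x\in G$, $a\in A$, $[x,a]=x^{-1}x^a$, and $[\phi_t,a]=\langle[x,a]:x\in\phi_t\rangle$. A subgroup is $A$-invariant if it is mapped to itself by every $a\in A$. Filter: for a group $H$, a filter is a function $\phi:M\to2^H$ (subsets of $H$), $s\mapsto\phi_s$, with each $\phi_s$ a subgroup, $[\phi_s,\phi_t]\leq\phi_{s+t}$ for all $s,t\in M$, and $\phi_s\geq\phi_t$ whenever $s\prec t$.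 Put $\partial_s\phi=\langle\phi_{s+t}:t\neq0\rangle$, $L_0(\phi)=0$, and $L_s(\phi)=\phi_s/\partial_s\phi$ for $s\neq0$. Then $L_*(\phi)=\bigoplus_{s\in M}L_s(\phi)$ is an $M$-graded Lie ring with product $\bar x\circ\bar y=\overline{[x,y]}\in L_{s+t}(\phi)$ for $x\in\phi_s$, $y\in\phi_t$ (terms in degree $0$ being $0$); bars denote cosets. Derivations: a derivation of a Lie ring $L$ is an additive map $D$, written on the right, with $(u\circ v)D=(uD)\circ v+u\circ(vD)$; $\operatorname{Der}(L)$ is a Lie ring under $[D,E]=DE-ED$ (first factor applied first). That the homomorphism is graded means that $L_s(\Delta\phi)$ is sent to derivations mapping $L_u(\phi)$ into $L_{s+u}(\phi)$ for all $u\in M$. *)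

theory Defs
  imports "HOL-Algebra.Algebra"
begin

class preordered_comm_monoid_add = comm_monoid_add + preorder +
  assumes zero_le_all: "0 \<le> s"
    and add_mono_preorder: "s \<le> t \<Longrightarrow> u \<le> v \<Longrightarrow> s + u \<le> t + v"

section \<open>Commutators and actions\<close>

definition commutator :: "('g, 'x) monoid_scheme \<Rightarrow> 'g \<Rightarrow> 'g \<Rightarrow> 'g" where
  "commutator H g h = inv\<^bsub>H\<^esub> g \<otimes>\<^bsub>H\<^esub> inv\<^bsub>H\<^esub> h \<otimes>\<^bsub>H\<^esub> g \<otimes>\<^bsub>H\<^esub> h"

definition commutator_subgroup :: "('g, 'x) monoid_scheme \<Rightarrow> 'g set \<Rightarrow> 'g set \<Rightarrow> 'g set" where
  "commutator_subgroup H U V = generate H {commutator H x y | x y. x \<in> U \<and> y \<in> V}"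

text \<open>The multiplication of \<^const>\<open>AutoGroup\<close> is \<open>f \<otimes> g = f \<circ> g\<close>, so that homomorphisms into it are
  left actions. A right action is a homomorphism into the same set of automorphisms with the
  product in which the first factor is applied first; \<open>x\<^sup>a\<close> is then \<open>\<theta> a x\<close>.\<close>

definition right_AutoGroup :: "('g, 'x) monoid_scheme \<Rightarrow> ('g \<Rightarrow> 'g) monoid" where
  "right_AutoGroup G = (AutoGroup G)\<lparr>mult := \<lambda>f g. g \<otimes>\<^bsub>AutoGroup G\<^esub> f\<rparr>"

definition invariant_under ::
  "('a, 'y) monoid_scheme \<Rightarrow> ('a \<Rightarrow> 'g \<Rightarrow> 'g) \<Rightarrow> 'g set \<Rightarrow> bool" where
  "invariant_under A \<theta> U \<longleftrightarrow> (\<forall>a\<in>carrier A. \<theta> a ` U \<subseteq> U)"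

definition act_commutator ::
  "('g, 'x) monoid_scheme \<Rightarrow> ('a \<Rightarrow> 'g \<Rightarrow> 'g) \<Rightarrow> 'g \<Rightarrow> 'a \<Rightarrow> 'g" where
  "act_commutator G \<theta> x a = inv\<^bsub>G\<^esub> x \<otimes>\<^bsub>G\<^esub> \<theta> a x"

definition act_commutator_subgroup ::
  "('g, 'x) monoid_scheme \<Rightarrow> ('a \<Rightarrow> 'g \<Rightarrow> 'g) \<Rightarrow> 'g set \<Rightarrow> 'a \<Rightarrow> 'g set" where
  "act_commutator_subgroup G \<theta> U a = generate G {act_commutator G \<theta> x a | x. x \<in> U}"

section \<open>Filters\<close>

locale group_filter = group H
  for H :: "('g, 'x) monoid_scheme" (structure)
    and \<phi> :: "'m::preordered_comm_monoid_add \<Rightarrow> 'g set" +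
  assumes filter_subgroup: "subgroup (\<phi> s) H"
    and filter_commutator: "commutator_subgroup H (\<phi> s) (\<phi> t) \<subseteq> \<phi> (s + t)"
    and filter_antimono: "s \<le> t \<Longrightarrow> \<phi> t \<subseteq> \<phi> s"

definition filter_boundary ::
  "('g, 'x) monoid_scheme \<Rightarrow> ('m::preordered_comm_monoid_add \<Rightarrow> 'g set) \<Rightarrow> 'm \<Rightarrow> 'g set" where
  "filter_boundary H \<phi> s = generate H (\<Union>t\<in>{t. t \<noteq> 0}. \<phi> (s + t))"

definition filter_Delta ::
  "('a, 'y) monoid_scheme \<Rightarrow> ('g, 'x) monoid_scheme \<Rightarrow> ('a \<Rightarrow> 'g \<Rightarrow> 'g) \<Rightarrow>
    ('m::preordered_comm_monoid_add \<Rightarrow> 'g set) \<Rightarrow> 'm \<Rightarrow> 'a set" where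
  "filter_Delta A G \<theta> \<phi> s =
    {a \<in> carrier A. \<forall>t. act_commutator_subgroup G \<theta> (\<phi> t) a \<subseteq> \<phi> (t + s)}"

section \<open>Lie rings and derivations\<close>

text \<open>Lie rings reuse the \<^type>\<open>ring\<close> record, with \<open>\<otimes>\<close> as the Lie product. A Lie ring has no unit, so
  the field \<^const>\<open>one\<close> carries no information and is left undefined.\<close>

locale lie_ring = abelian_group L
  for L :: "('l, 'x) ring_scheme" (structure) +
  assumes lie_closed: "x \<in> carrier L \<Longrightarrow> y \<in> carrier L \<Longrightarrow> x \<otimes> y \<in> carrier L"
    and lie_l_distr: "x \<in> carrier L \<Longrightarrow> y \<in> carrier L \<Longrightarrow> z \<in> carrier L \<Longrightarrow>
      (x \<oplus> y) \<otimes> z = (x \<otimes> z) \<oplus> (y \<otimes> z)"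
    and lie_r_distr: "x \<in> carrier L \<Longrightarrow> y \<in> carrier L \<Longrightarrow> z \<in> carrier L \<Longrightarrow>
      z \<otimes> (x \<oplus> y) = (z \<otimes> x) \<oplus> (z \<otimes> y)"
    and lie_alternating: "x \<in> carrier L \<Longrightarrow> x \<otimes> x = \<zero>"
    and lie_jacobi: "x \<in> carrier L \<Longrightarrow> y \<in> carrier L \<Longrightarrow> z \<in> carrier L \<Longrightarrow>
      ((x \<otimes> y) \<otimes> z) \<oplus> ((y \<otimes> z) \<otimes> x) \<oplus> ((z \<otimes> x) \<otimes> y) = \<zero>"

locale lie_ring_hom = L: lie_ring L + K: lie_ring K
  for L :: "('l, 'x) ring_scheme" and K :: "('k, 'y) ring_scheme" and h :: "'l \<Rightarrow> 'k" +
  assumes hom_closed: "x \<in> carrier L \<Longrightarrow> h x \<in> carrier K"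
    and hom_add: "x \<in> carrier L \<Longrightarrow> y \<in> carrier L \<Longrightarrow> h (x \<oplus>\<^bsub>L\<^esub> y) = h x \<oplus>\<^bsub>K\<^esub> h y"
    and hom_lie: "x \<in> carrier L \<Longrightarrow> y \<in> carrier L \<Longrightarrow> h (x \<otimes>\<^bsub>L\<^esub> y) = h x \<otimes>\<^bsub>K\<^esub> h y"

text \<open>Derivations are extensional, so that they are determined by their values on the carrier.
  They are written on the right: \<open>uD\<close> is \<open>D u\<close>, and \<open>DE\<close> is \<open>\<lambda>u. E (D u)\<close>.\<close>

definition derivation :: "('l, 'x) ring_scheme \<Rightarrow> ('l \<Rightarrow> 'l) \<Rightarrow> bool" where
  "derivation L D \<longleftrightarrow>
    D \<in> carrier L \<rightarrow>\<^sub>E carrier L \<and>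
    (\<forall>u\<in>carrier L. \<forall>v\<in>carrier L. D (u \<oplus>\<^bsub>L\<^esub> v) = D u \<oplus>\<^bsub>L\<^esub> D v) \<and>
    (\<forall>u\<in>carrier L. \<forall>v\<in>carrier L.
      D (u \<otimes>\<^bsub>L\<^esub> v) = (D u \<otimes>\<^bsub>L\<^esub> v) \<oplus>\<^bsub>L\<^esub> (u \<otimes>\<^bsub>L\<^esub> D v))"

definition Der :: "('l, 'x) ring_scheme \<Rightarrow> ('l \<Rightarrow> 'l) ring" where
  "Der L =
    \<lparr>carrier = {D. derivation L D},
     monoid.mult = \<lambda>D E. \<lambda>u\<in>carrier L. E (D u) \<ominus>\<^bsub>L\<^esub> D (E u),
     one = undefined,
     ring.zero = \<lambda>u\<in>carrier L. \<zero>\<^bsub>L\<^esub>,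
     ring.add = \<lambda>D E. \<lambda>u\<in>carrier L. D u \<oplus>\<^bsub>L\<^esub> E u\<rparr>"

section \<open>The graded Lie ring of a filter\<close>

text \<open>The zero group \<open>L\<^sub>0\<close> is realised as \<open>\<phi>\<^sub>0 / \<phi>\<^sub>0\<close>. In this way the coset \<open>bar\<close> of an element of
  \<open>\<phi>\<^sub>s\<close> makes sense in every degree, and it is zero in degree \<open>0\<close>.\<close>

definition gr_kernel ::
  "('g, 'x) monoid_scheme \<Rightarrow> ('m::preordered_comm_monoid_add \<Rightarrow> 'g set) \<Rightarrow> 'm \<Rightarrow> 'g set" where
  "gr_kernel H \<phi> s = (if s = 0 then \<phi> 0 else filter_boundary H \<phi> s)"

definition gr ::
  "('g, 'x) monoid_scheme \<Rightarrow> ('m::preordered_comm_monoid_add \<Rightarrow> 'g set) \<Rightarrow> 'm \<Rightarrow> 'g set monoid" where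
  "gr H \<phi> s = H\<lparr>carrier := \<phi> s\<rparr> Mod gr_kernel H \<phi> s"

definition bar ::
  "('g, 'x) monoid_scheme \<Rightarrow> ('m::preordered_comm_monoid_add \<Rightarrow> 'g set) \<Rightarrow> 'm \<Rightarrow> 'g \<Rightarrow> 'g set" where
  "bar H \<phi> s x = gr_kernel H \<phi> s #>\<^bsub>H\<^esub> x"

text \<open>For \<open>s, t \<noteq> 0\<close> the class of \<open>[x, y]\<close> does not depend on the representatives \<open>x \<in> U\<close> and
  \<open>y \<in> V\<close>, so the union below is the single coset of \<open>[x, y]\<close> in \<open>L\<^sub>s\<^sub>+\<^sub>t\<close>. It is not used
  for \<open>s = 0\<close> or \<open>t = 0\<close>: there is no nonzero element of degree \<open>0\<close>, and \<open>gr_bracket\<close> sums over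
  pairs of nonzero components only.\<close>

definition gr_product ::
  "('g, 'x) monoid_scheme \<Rightarrow> ('m::preordered_comm_monoid_add \<Rightarrow> 'g set) \<Rightarrow> 'm \<Rightarrow> 'm \<Rightarrow>
    'g set \<Rightarrow> 'g set \<Rightarrow> 'g set" where
  "gr_product H \<phi> s t U V = (\<Union>x\<in>U. \<Union>y\<in>V. bar H \<phi> (s + t) (commutator H x y))"

definition gr_bracket ::
  "('g, 'x) monoid_scheme \<Rightarrow> ('m::preordered_comm_monoid_add \<Rightarrow> 'g set) \<Rightarrow>
    ('m \<Rightarrow> 'g set) \<Rightarrow> ('m \<Rightarrow> 'g set) \<Rightarrow> 'm \<Rightarrow> 'g set" where
  "gr_bracket H \<phi> f g w =
    finprod (gr H \<phi> w) (\<lambda>(s, t). gr_product H \<phi> s t (f s) (g t))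
      {(s, t). s + t = w \<and> f s \<noteq> \<one>\<^bsub>gr H \<phi> s\<^esub> \<and> g t \<noteq> \<one>\<^bsub>gr H \<phi> t\<^esub>}"

definition filter_lie_ring ::
  "('g, 'x) monoid_scheme \<Rightarrow> ('m::preordered_comm_monoid_add \<Rightarrow> 'g set) \<Rightarrow> ('m \<Rightarrow> 'g set) ring" where
  "filter_lie_ring H \<phi> =
    \<lparr>carrier = carrier (sum_group UNIV (gr H \<phi>)),
     monoid.mult = gr_bracket H \<phi>,
     one = undefined,
     ring.zero = \<one>\<^bsub>sum_group UNIV (gr H \<phi>)\<^esub>,
     ring.add = monoid.mult (sum_group UNIV (gr H \<phi>))\<rparr>"

definition gr_inclusion ::
  "('g, 'x) monoid_scheme \<Rightarrow> ('m::preordered_comm_monoid_add \<Rightarrow> 'g set) \<Rightarrow> 'm \<Rightarrow> 'g set \<Rightarrow>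
    'm \<Rightarrow> 'g set" where
  "gr_inclusion H \<phi> s U = (\<lambda>u. if u = s then U else \<one>\<^bsub>gr H \<phi> u\<^esub>)"

definition homogeneous ::
  "('g, 'x) monoid_scheme \<Rightarrow> ('m::preordered_comm_monoid_add \<Rightarrow> 'g set) \<Rightarrow> 'm \<Rightarrow> ('m \<Rightarrow> 'g set) set" where
  "homogeneous H \<phi> s = gr_inclusion H \<phi> s ` carrier (gr H \<phi> s)"

definition hbar ::
  "('g, 'x) monoid_scheme \<Rightarrow> ('m::preordered_comm_monoid_add \<Rightarrow> 'g set) \<Rightarrow> 'm \<Rightarrow> 'g \<Rightarrow> 'm \<Rightarrow> 'g set" where
  "hbar H \<phi> s x = gr_inclusion H \<phi> s (bar H \<phi> s x)"

definition graded_into_Der ::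
  "('a, 'y) monoid_scheme \<Rightarrow> ('m::preordered_comm_monoid_add \<Rightarrow> 'a set) \<Rightarrow>
    ('g, 'x) monoid_scheme \<Rightarrow> ('m \<Rightarrow> 'g set) \<Rightarrow>
    (('m \<Rightarrow> 'a set) \<Rightarrow> ('m \<Rightarrow> 'g set) \<Rightarrow> ('m \<Rightarrow> 'g set)) \<Rightarrow> bool" where
  "graded_into_Der A \<psi> G \<phi> h \<longleftrightarrow>
    (\<forall>s u. \<forall>v\<in>homogeneous A \<psi> s. \<forall>w\<in>homogeneous G \<phi> u. h v w \<in> homogeneous G \<phi> (s + u))"

definition is_commutator_derivation ::
  "('g, 'x) monoid_scheme \<Rightarrow> ('a \<Rightarrow> 'g \<Rightarrow> 'g) \<Rightarrow> ('m::preordered_comm_monoid_add \<Rightarrow> 'g set) \<Rightarrow>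
    'm \<Rightarrow> 'a \<Rightarrow> (('m \<Rightarrow> 'g set) \<Rightarrow> ('m \<Rightarrow> 'g set)) \<Rightarrow> bool" where
  "is_commutator_derivation G \<theta> \<phi> s a D \<longleftrightarrow>
    derivation (filter_lie_ring G \<phi>) D \<and>
    (\<forall>u x. u \<noteq> 0 \<longrightarrow> x \<in> \<phi> u \<longrightarrow>
      D (hbar G \<phi> u x) = hbar G \<phi> (s + u) (act_commutator G \<theta> x a))"

end

theory Submission
  imports Defs
begin

text \<open>Everything rests on commutator calculus in a filter: expand a commutator exactly, and discard the
  factors whose degree exceeds the degree under consideration by a nonzero summand, since these vanish
  in the associated graded group.

  A single construction yields all products. A commutation map \<open>c\<close> that sends \<open>\<phi>\<^sub>s\<close> and \<open>\<psi>\<^sub>t\<close> into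
  \<open>\<chi>\<^sub>s\<^sub>+\<^sub>t\<close> and is additive in each argument up to deeper terms induces a biadditive pairing of the
  direct sums of the homogeneous components (locale \<open>filter_pairing\<close>). It is well defined because the
  denominators are generated by deeper terms. Taking for \<open>c\<close> the commutator of a group gives the Lie
  bracket of a filter; taking \<open>[x,a]\<close> for \<open>x \<in> \<phi>\<^sub>u\<close> and \<open>a \<in> \<Delta>\<^sub>s\<phi>\<close> gives an additive action of
  \<open>L(\<Delta>\<phi>)\<close> on \<open>L(\<phi>)\<close>.

  Since the classes of nonzero degree generate, each identity reduces to one for group elements: the Jacobi
  identity is the Hall-Witt identity (\<open>bracket_jacobi\<close>), the Leibniz rule is the expansion of
  \<open>[x[x,a], y[y,a]] = [x,y]\<^sup>a\<close> (\<open>act_leibniz\<close>), and compatibility with the bracket is the comparison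
  of \<open>y\<^sup>a\<^sup>b\<close> with \<open>y\<^sup>b\<^sup>a\<close> (\<open>act_bracket\<close>). The same comparison shows that \<open>\<Delta>\<phi>\<close> satisfies the
  commutator condition of a filter (\<open>group_filter_Delta\<close>); the other conditions follow from the
  invariance of the \<open>\<phi>\<^sub>s\<close>.\<close>

section \<open>Commutator identities\<close>

context group begin

lemma inv_cancel_left:
  "x \<in> carrier G \<Longrightarrow> y \<in> carrier G \<Longrightarrow> inv x \<otimes> (x \<otimes> y) = y"
  "x \<in> carrier G \<Longrightarrow> y \<in> carrier G \<Longrightarrow> x \<otimes> (inv x \<otimes> y) = y"
  by (simp_all flip: m_assoc)

lemmas word_simps = m_assoc inv_mult_group inv_cancel_left

lemma commutator_closed:
  "x \<in> carrier G \<Longrightarrow> y \<in> carrier G \<Longrightarrow> commutator G x y \<in> carrier G"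
  by (simp add: commutator_def)

lemma commutator_self: "x \<in> carrier G \<Longrightarrow> commutator G x x = \<one>"
  by (simp add: commutator_def word_simps)

lemma inv_commutator:
  "x \<in> carrier G \<Longrightarrow> y \<in> carrier G \<Longrightarrow> inv (commutator G x y) = commutator G y x"
  by (simp add: commutator_def word_simps)

lemma conj_eq_mult_commutator:
  "x \<in> carrier G \<Longrightarrow> g \<in> carrier G \<Longrightarrow> inv g \<otimes> x \<otimes> g = x \<otimes> commutator G x g"
  by (simp add: commutator_def word_simps)

lemma commutator_mult_left:
  assumes "x \<in> carrier G" "y \<in> carrier G" "z \<in> carrier G"
  shows "commutator G (x \<otimes> y) z =
    commutator G x z \<otimes> (commutator G (commutator G x z) y \<otimes> commutator G y z)"
  using assms by (simp add: commutator_def word_simps)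

lemma commutator_mult_right:
  assumes "x \<in> carrier G" "y \<in> carrier G" "z \<in> carrier G"
  shows "commutator G x (y \<otimes> z) =
    commutator G x z \<otimes> (commutator G x y \<otimes> commutator G (commutator G x y) z)"
  using assms by (simp add: commutator_def word_simps)

text \<open>The Hall-Witt identity. Modulo deeper commutators the three conjugations disappear, and it
  becomes the Jacobi identity.\<close>

lemma hall_witt:
  assumes "x \<in> carrier G" "y \<in> carrier G" "z \<in> carrier G"
  shows "(inv y \<otimes> commutator G (commutator G x (inv y)) z \<otimes> y) \<otimes>
    ((inv z \<otimes> commutator G (commutator G y (inv z)) x \<otimes> z) \<otimes>
     (inv x \<otimes> commutator G (commutator G z (inv x)) y \<otimes> x)) = \<one>"
  using assms by (simp add: commutator_def word_simps)

text \<open>With \<open>p = [x,a]\<close> and \<open>q = [y,a]\<close> the left-hand side is \<open>[[x,y],a]\<close>. On the right, modulo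
  deeper commutators, only \<open>[x p, q]\<close>, hence \<open>[x,q]\<close>, and \<open>[p,y]\<close> survive: this is the Leibniz rule.\<close>

lemma commutator_perturbed:
  assumes "x \<in> carrier G" "y \<in> carrier G" "p \<in> carrier G" "q \<in> carrier G"
  shows "inv (commutator G x y) \<otimes> commutator G (x \<otimes> p) (y \<otimes> q) =
    (inv (commutator G x y) \<otimes> commutator G (x \<otimes> p) q \<otimes> commutator G x y) \<otimes>
    (commutator G (commutator G x y) q \<otimes>
     ((inv q \<otimes> commutator G (commutator G x y) p \<otimes> q) \<otimes>
      (inv q \<otimes> commutator G p y \<otimes> q)))"
  using assms by (simp add: commutator_def word_simps)

text \<open>Normality comes from \<open>x k x\<^sup>-\<^sup>1 = k [k, x\<^sup>-\<^sup>1]\<close>.\<close>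

lemma commutators_in_subgroup_imp_normal:
  assumes K: "subgroup K G"
    and comm: "\<And>x y. x \<in> carrier G \<Longrightarrow> y \<in> carrier G \<Longrightarrow> commutator G x y \<in> K"
  shows "K \<lhd> G" and "comm_group (G Mod K)"
proof -
  show N: "K \<lhd> G"
    unfolding normal_inv_iff
  proof (intro conjI ballI K)
    fix x k assume x: "x \<in> carrier G" and k: "k \<in> K"
    have kc: "k \<in> carrier G" using K k by (rule subgroup.mem_carrier)
    have "x \<otimes> k \<otimes> inv x = k \<otimes> commutator G k (inv x)"
      using x kc by (simp add: commutator_def word_simps)
    also have "\<dots> \<in> K"
      using K k comm[OF kc inv_closed[OF x]] by (rule subgroup.m_closed)
    finally show "x \<otimes> k \<otimes> inv x \<in> K" .
  qed
  interpret N: normal K G by (rule N)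
  show "comm_group (G Mod K)"
  proof (rule group.group_comm_groupI[OF N.factorgroup_is_group])
    fix U V assume "U \<in> carrier (G Mod K)" "V \<in> carrier (G Mod K)"
    then obtain x y where x: "x \<in> carrier G" "U = K #> x" and y: "y \<in> carrier G" "V = K #> y"
      by (auto simp: carrier_FactGroup)
    have "x \<otimes> y = commutator G (inv x) (inv y) \<otimes> (y \<otimes> x)"
      using x y by (simp add: commutator_def word_simps)
    then have "x \<otimes> y \<in> K #> (y \<otimes> x)"
      using comm[of "inv x" "inv y"] x y by (auto simp: r_coset_def)
    then have "K #> (x \<otimes> y) = K #> (y \<otimes> x)"
      using x y K by (metis repr_independence m_closed)
    then show "U \<otimes>\<^bsub>G Mod K\<^esub> V = V \<otimes>\<^bsub>G Mod K\<^esub> U"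
      using x y by (simp add: N.rcos_sum)
  qed
qed

end

section \<open>Direct sums and graded pairings\<close>

lemma carrier_sum_group_UNIV:
  assumes "\<And>s. group (L s)"
  shows "carrier (sum_group UNIV L) = {f. (\<forall>s. f s \<in> carrier (L s)) \<and> finite {s. f s \<noteq> \<one>\<^bsub>L s\<^esub>}}"
  using assms by (subst carrier_sum_group) auto

lemma comm_group_sum_group:
  assumes "\<And>s. comm_group (L s)"
  shows "comm_group (sum_group UNIV L)"
proof -
  have g: "\<And>s. group (L s)" using assms by (rule comm_group.axioms)
  show ?thesis
  proof (rule group.group_comm_groupI)
    show "group (sum_group UNIV L)" by (simp add: g)
    fix f h assume "f \<in> carrier (sum_group UNIV L)" "h \<in> carrier (sum_group UNIV L)"
    then show "f \<otimes>\<^bsub>sum_group UNIV L\<^esub> h = h \<otimes>\<^bsub>sum_group UNIV L\<^esub> f"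
      using assms by (auto simp: carrier_sum_group_UNIV g comm_group_def comm_monoid.m_comm)
  qed
qed

lemma sum_group_induct [consumes 2, case_names one single mult]:
  assumes g: "\<And>s. group (L s)"
    and f: "f \<in> carrier (sum_group UNIV L)"
    and one: "P \<one>\<^bsub>sum_group UNIV L\<^esub>"
    and single: "\<And>s U. U \<in> carrier (L s) \<Longrightarrow> P (\<lambda>u. if u = s then U else \<one>\<^bsub>L u\<^esub>)"
    and mult: "\<And>f h. f \<in> carrier (sum_group UNIV L) \<Longrightarrow> h \<in> carrier (sum_group UNIV L) \<Longrightarrow>
      P f \<Longrightarrow> P h \<Longrightarrow> P (f \<otimes>\<^bsub>sum_group UNIV L\<^esub> h)"
  shows "P f"
proof -
  have m: "monoid (L s)" for s using g by (rule group.is_monoid)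
  have "\<forall>f\<in>carrier (sum_group UNIV L). {s. f s \<noteq> \<one>\<^bsub>L s\<^esub>} \<subseteq> S \<longrightarrow> P f" if "finite S" for S
    using that
  proof (induction S)
    case empty
    have "f = \<one>\<^bsub>sum_group UNIV L\<^esub>" if "{s. f s \<noteq> \<one>\<^bsub>L s\<^esub>} \<subseteq> {}" for f :: "'a \<Rightarrow> 'b"
      using that by auto
    with one show ?case by metis
  next
    case (insert s S)
    show ?case
    proof (intro ballI impI)
      fix f assume f: "f \<in> carrier (sum_group UNIV L)" and S: "{s. f s \<noteq> \<one>\<^bsub>L s\<^esub>} \<subseteq> insert s S"
      define a where "a = (\<lambda>u. if u = s then f s else \<one>\<^bsub>L u\<^esub>)"
      define b where "b = f(s := \<one>\<^bsub>L s\<^esub>)"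
      have fs: "f u \<in> carrier (L u)" for u using f by (simp add: carrier_sum_group_UNIV g)
      have "P a" unfolding a_def by (rule single) (rule fs)
      have a: "a \<in> carrier (sum_group UNIV L)"
        using fs m by (auto simp: carrier_sum_group_UNIV g a_def monoid.one_closed)
      have "finite {u. b u \<noteq> \<one>\<^bsub>L u\<^esub>}"
        by (rule finite_subset[where B = "{u. f u \<noteq> \<one>\<^bsub>L u\<^esub>}"])
           (use f in \<open>auto simp: carrier_sum_group_UNIV g b_def\<close>)
      then have b: "b \<in> carrier (sum_group UNIV L)"
        using fs m by (auto simp: carrier_sum_group_UNIV g b_def monoid.one_closed)
      have "{u. b u \<noteq> \<one>\<^bsub>L u\<^esub>} \<subseteq> S" using S by (auto simp: b_def)
      then have "P b" using insert.IH b by blast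
      moreover have "f = a \<otimes>\<^bsub>sum_group UNIV L\<^esub> b"
        using fs m by (auto simp: a_def b_def fun_eq_iff monoid.l_one monoid.r_one)
      ultimately show "P f" using \<open>P a\<close> mult[OF a b] by simp
    qed
  qed
  moreover have "finite {s. f s \<noteq> \<one>\<^bsub>L s\<^esub>}" using f by (simp add: carrier_sum_group_UNIV g)
  ultimately show ?thesis using f by blast
qed

text \<open>A pairing of homogeneous components extends to direct sums as a finite sum over the pairs of
  nonzero components. The sum ranges over supports that depend on the arguments, so additivity is proved
  after replacing them by larger finite sets common to all arguments.\<close>

definition graded_product ::
  "('m::comm_monoid_add \<Rightarrow> 'l monoid) \<Rightarrow> ('m \<Rightarrow> 'k monoid) \<Rightarrow> ('m \<Rightarrow> 'n monoid) \<Rightarrow>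
    ('m \<Rightarrow> 'm \<Rightarrow> 'l \<Rightarrow> 'k \<Rightarrow> 'n) \<Rightarrow> ('m \<Rightarrow> 'l) \<Rightarrow> ('m \<Rightarrow> 'k) \<Rightarrow> 'm \<Rightarrow> 'n" where
  "graded_product L K N p f g w =
    finprod (N w) (\<lambda>(s, t). p s t (f s) (g t))
      {(s, t). s + t = w \<and> f s \<noteq> \<one>\<^bsub>L s\<^esub> \<and> g t \<noteq> \<one>\<^bsub>K t\<^esub>}"

text \<open>The laws are stated in nonzero degrees because the pairings of cosets to come are not well defined
  in degree zero. Since the components of degree zero are trivial, the laws in nonzero degrees still
  determine the pairing of the direct sums.\<close>

locale graded_pairing =
  fixes L :: "'m::comm_monoid_add \<Rightarrow> 'l monoid" and K :: "'m \<Rightarrow> 'k monoid" and N :: "'m \<Rightarrow> 'n monoid"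
    and p :: "'m \<Rightarrow> 'm \<Rightarrow> 'l \<Rightarrow> 'k \<Rightarrow> 'n"
  assumes comm_L: "comm_group (L s)" and comm_K: "comm_group (K s)" and comm_N: "comm_group (N s)"
    and L_zero: "carrier (L 0) = {\<one>\<^bsub>L 0\<^esub>}" and K_zero: "carrier (K 0) = {\<one>\<^bsub>K 0\<^esub>}"
    and p_closed: "s \<noteq> 0 \<Longrightarrow> t \<noteq> 0 \<Longrightarrow> U \<in> carrier (L s) \<Longrightarrow> V \<in> carrier (K t) \<Longrightarrow>
      p s t U V \<in> carrier (N (s + t))"
    and p_left: "s \<noteq> 0 \<Longrightarrow> t \<noteq> 0 \<Longrightarrow> U \<in> carrier (L s) \<Longrightarrow> U' \<in> carrier (L s) \<Longrightarrow>
      V \<in> carrier (K t) \<Longrightarrow> p s t (U \<otimes>\<^bsub>L s\<^esub> U') V = p s t U V \<otimes>\<^bsub>N (s + t)\<^esub> p s t U' V"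
    and p_right: "s \<noteq> 0 \<Longrightarrow> t \<noteq> 0 \<Longrightarrow> U \<in> carrier (L s) \<Longrightarrow> V \<in> carrier (K t) \<Longrightarrow>
      V' \<in> carrier (K t) \<Longrightarrow> p s t U (V \<otimes>\<^bsub>K t\<^esub> V') = p s t U V \<otimes>\<^bsub>N (s + t)\<^esub> p s t U V'"
begin

lemma group_L: "group (L s)" and group_K: "group (K s)" and group_N: "group (N s)"
  by (rule comm_group.axioms, rule comm_L comm_K comm_N)+

lemma p_one_left:
  assumes "s \<noteq> 0" "t \<noteq> 0" "V \<in> carrier (K t)"
  shows "p s t \<one>\<^bsub>L s\<^esub> V = \<one>\<^bsub>N (s + t)\<^esub>"
proof -
  have "(\<lambda>U. p s t U V) \<in> hom (L s) (N (s + t))"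
    using assms by (auto simp: hom_def p_closed p_left)
  then show ?thesis by (rule hom_one[OF _ group_L group_N])
qed

lemma p_one_right:
  assumes "s \<noteq> 0" "t \<noteq> 0" "U \<in> carrier (L s)"
  shows "p s t U \<one>\<^bsub>K t\<^esub> = \<one>\<^bsub>N (s + t)\<^esub>"
proof -
  have "(\<lambda>V. p s t U V) \<in> hom (K t) (N (s + t))"
    using assms by (auto simp: hom_def p_closed p_right)
  then show ?thesis by (rule hom_one[OF _ group_K group_N])
qed

abbreviation "supp_L f \<equiv> {s. f s \<noteq> \<one>\<^bsub>L s\<^esub>}"
abbreviation "supp_K g \<equiv> {s. g s \<noteq> \<one>\<^bsub>K s\<^esub>}"

lemma supports:
  assumes "f \<in> carrier (sum_group UNIV L)" "g \<in> carrier (sum_group UNIV K)"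
  shows "finite (supp_L f)" "0 \<notin> supp_L f" "f s \<in> carrier (L s)"
    and "finite (supp_K g)" "0 \<notin> supp_K g" "g t \<in> carrier (K t)"
  using assms L_zero K_zero by (auto simp: carrier_sum_group_UNIV group_L group_K)

lemma graded_product_eq_finprod:
  assumes f: "f \<in> carrier (sum_group UNIV L)" and g: "g \<in> carrier (sum_group UNIV K)"
    and S: "finite S" "0 \<notin> S" "supp_L f \<subseteq> S" and T: "finite T" "0 \<notin> T" "supp_K g \<subseteq> T"
  shows "graded_product L K N p f g w =
    finprod (N w) (\<lambda>(s, t). p s t (f s) (g t)) {(s, t) \<in> S \<times> T. s + t = w}"
    (is "_ = finprod _ ?F ?I")
    and "(\<lambda>(s, t). p s t (f s) (g t)) \<in> {(s, t) \<in> S \<times> T. s + t = w} \<rightarrow> carrier (N w)"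
proof -
  interpret N: comm_group "N w" by (rule comm_N)
  note fg = supports[OF f g]
  show F: "?F \<in> ?I \<rightarrow> carrier (N w)"
    using S(2) T(2) fg by (auto intro!: p_closed)
  have fin: "finite ?I" using S T by (auto intro: finite_subset[of _ "S \<times> T"])
  have one: "?F i = \<one>\<^bsub>N w\<^esub>"
    if "i \<in> ?I - {(s, t). s + t = w \<and> f s \<noteq> \<one>\<^bsub>L s\<^esub> \<and> g t \<noteq> \<one>\<^bsub>K t\<^esub>}" for i
  proof -
    obtain s t where i: "i = (s, t)" "s \<in> S" "t \<in> T" "s + t = w" "f s = \<one>\<^bsub>L s\<^esub> \<or> g t = \<one>\<^bsub>K t\<^esub>"
      using \<open>i \<in> _\<close> by auto
    moreover have "s \<noteq> 0" "t \<noteq> 0" using i S T by auto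
    ultimately show ?thesis using p_one_left p_one_right fg by auto
  qed
  show "graded_product L K N p f g w = finprod (N w) ?F ?I"
    unfolding graded_product_def
    by (rule N.finprod_mono_neutral_cong_left[OF fin _ one refl F]) (use S T in auto)
qed

lemma graded_product_closed:
  assumes f: "f \<in> carrier (sum_group UNIV L)" and g: "g \<in> carrier (sum_group UNIV K)"
  shows "graded_product L K N p f g \<in> carrier (sum_group UNIV N)"
proof -
  note fg = supports[OF f g]
  note eq = graded_product_eq_finprod[OF f g fg(1,2) order_refl fg(4,5) order_refl]
  have "graded_product L K N p f g w \<in> carrier (N w)" for w
  proof -
    interpret N: comm_group "N w" by (rule comm_N)
    show ?thesis unfolding eq(1) by (rule N.finprod_closed) (rule eq(2))
  qed
  moreover have "finite {w. graded_product L K N p f g w \<noteq> \<one>\<^bsub>N w\<^esub>}"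
  proof (rule finite_subset)
    show "finite ((\<lambda>(s, t). s + t) ` (supp_L f \<times> supp_K g))" using fg by simp
    show "{w. graded_product L K N p f g w \<noteq> \<one>\<^bsub>N w\<^esub>} \<subseteq> (\<lambda>(s, t). s + t) ` (supp_L f \<times> supp_K g)"
    proof (rule subsetI, rule ccontr)
      fix w assume w: "w \<in> {w. graded_product L K N p f g w \<noteq> \<one>\<^bsub>N w\<^esub>}"
        and "w \<notin> (\<lambda>(s, t). s + t) ` (supp_L f \<times> supp_K g)"
      then have "{(s, t). s + t = w \<and> f s \<noteq> \<one>\<^bsub>L s\<^esub> \<and> g t \<noteq> \<one>\<^bsub>K t\<^esub>} = {}"
        by (auto simp: image_iff)
      then have "graded_product L K N p f g w = \<one>\<^bsub>N w\<^esub>"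
        unfolding graded_product_def
        by (simp only: comm_monoid.finprod_empty[OF comm_group.axioms(1)[OF comm_N]])
      then show False using w by simp
    qed
  qed
  ultimately show ?thesis by (simp add: carrier_sum_group_UNIV group_N)
qed

lemma graded_product_mult_left:
  assumes f: "f \<in> carrier (sum_group UNIV L)" and f': "f' \<in> carrier (sum_group UNIV L)"
    and g: "g \<in> carrier (sum_group UNIV K)"
  shows "graded_product L K N p (f \<otimes>\<^bsub>sum_group UNIV L\<^esub> f') g =
    graded_product L K N p f g \<otimes>\<^bsub>sum_group UNIV N\<^esub> graded_product L K N p f' g"
proof (rule ext)
  fix w
  interpret SL: group "sum_group UNIV L" by (simp add: group_L)
  interpret N: comm_group "N w" by (rule comm_N)
  let ?h = "f \<otimes>\<^bsub>sum_group UNIV L\<^esub> f'"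
  have h: "?h \<in> carrier (sum_group UNIV L)" using f f' by (rule SL.m_closed)
  define S where "S = supp_L f \<union> supp_L f' \<union> supp_L ?h"
  note fg = supports[OF f g] supports[OF f' g] supports[OF h g]
  have S: "finite S" "0 \<notin> S" "supp_L f \<subseteq> S" "supp_L f' \<subseteq> S" "supp_L ?h \<subseteq> S"
    using fg by (auto simp: S_def)
  note T = fg(4,5) order_refl
  note eq = graded_product_eq_finprod[OF f g S(1,2,3) T, of w]
    graded_product_eq_finprod[OF f' g S(1,2,4) T, of w]
  show "graded_product L K N p ?h g w =
    (graded_product L K N p f g \<otimes>\<^bsub>sum_group UNIV N\<^esub> graded_product L K N p f' g) w"
    unfolding graded_product_eq_finprod(1)[OF h g S(1,2,5) T]
    unfolding mult_sum_group restrict_UNIV eq(1,3) N.finprod_multf[OF eq(2,4), symmetric]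
    by (rule N.finprod_cong') (use fg S(2) in \<open>auto intro!: monoid.m_closed[OF group.is_monoid[OF group_N]] p_closed p_left\<close>)
qed

lemma graded_product_mult_right:
  assumes f: "f \<in> carrier (sum_group UNIV L)" and g: "g \<in> carrier (sum_group UNIV K)"
    and g': "g' \<in> carrier (sum_group UNIV K)"
  shows "graded_product L K N p f (g \<otimes>\<^bsub>sum_group UNIV K\<^esub> g') =
    graded_product L K N p f g \<otimes>\<^bsub>sum_group UNIV N\<^esub> graded_product L K N p f g'"
proof (rule ext)
  fix w
  interpret SK: group "sum_group UNIV K" by (simp add: group_K)
  interpret N: comm_group "N w" by (rule comm_N)
  let ?h = "g \<otimes>\<^bsub>sum_group UNIV K\<^esub> g'"
  have h: "?h \<in> carrier (sum_group UNIV K)" using g g' by (rule SK.m_closed)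
  define T where "T = supp_K g \<union> supp_K g' \<union> supp_K ?h"
  note fg = supports[OF f g] supports[OF f g'] supports[OF f h]
  have T: "finite T" "0 \<notin> T" "supp_K g \<subseteq> T" "supp_K g' \<subseteq> T" "supp_K ?h \<subseteq> T"
    using fg by (auto simp: T_def)
  note S = fg(1,2) order_refl
  note eq = graded_product_eq_finprod[OF f g S T(1,2,3), of w]
    graded_product_eq_finprod[OF f g' S T(1,2,4), of w]
  show "graded_product L K N p f ?h w =
    (graded_product L K N p f g \<otimes>\<^bsub>sum_group UNIV N\<^esub> graded_product L K N p f g') w"
    unfolding graded_product_eq_finprod(1)[OF f h S T(1,2,5)]
    unfolding mult_sum_group restrict_UNIV eq(1,3) N.finprod_multf[OF eq(2,4), symmetric]
    by (rule N.finprod_cong') (use fg T(2) in \<open>auto intro!: monoid.m_closed[OF group.is_monoid[OF group_N]] p_closed p_right\<close>)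
qed

lemma graded_product_single:
  assumes s: "s \<noteq> 0" "U \<in> carrier (L s)" and t: "t \<noteq> 0" "V \<in> carrier (K t)"
  shows "graded_product L K N p (\<lambda>u. if u = s then U else \<one>\<^bsub>L u\<^esub>)
      (\<lambda>u. if u = t then V else \<one>\<^bsub>K u\<^esub>) =
    (\<lambda>u. if u = s + t then p s t U V else \<one>\<^bsub>N u\<^esub>)" (is "graded_product _ _ _ _ ?f ?g = _")
proof (rule ext)
  fix w
  interpret N: comm_group "N w" by (rule comm_N)
  have f: "?f \<in> carrier (sum_group UNIV L)"
    using s by (auto simp: carrier_sum_group_UNIV group_L monoid.one_closed group.is_monoid)
  have g: "?g \<in> carrier (sum_group UNIV K)"
    using t by (auto simp: carrier_sum_group_UNIV group_K monoid.one_closed group.is_monoid)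
  have eq: "graded_product L K N p ?f ?g w =
    finprod (N w) (\<lambda>(s, t). p s t (?f s) (?g t)) {(s', t') \<in> {s} \<times> {t}. s' + t' = w}"
    by (rule graded_product_eq_finprod(1)[OF f g, of "{s}" "{t}" w]) (use s t in auto)
  show "graded_product L K N p ?f ?g w = (if w = s + t then p s t U V else \<one>\<^bsub>N w\<^esub>)"
  proof (cases "w = s + t")
    case True
    then have I: "{(s', t') \<in> {s} \<times> {t}. s' + t' = w} = insert (s, t) {}" by auto
    have "p s t U V \<in> carrier (N w)" using s t True by (auto intro: p_closed)
    then show ?thesis unfolding eq I by (simp flip: True)
  next
    case False
    then have I: "{(s', t') \<in> {s} \<times> {t}. s' + t' = w} = {}" by auto
    show ?thesis unfolding eq I using False by simp
  qed
qed

end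

section \<open>The homogeneous components of a filter\<close>

context group_filter
begin

abbreviation "filter_group s \<equiv> H\<lparr>carrier := \<phi> s\<rparr>"

lemma group_filter_group: "group (filter_group s)"
  by (rule subgroup.subgroup_is_group[OF filter_subgroup group_axioms])

lemma filter_closed:
  "x \<in> \<phi> s \<Longrightarrow> x \<in> carrier H" "x \<in> \<phi> s \<Longrightarrow> y \<in> \<phi> s \<Longrightarrow> x \<otimes> y \<in> \<phi> s"
  "x \<in> \<phi> s \<Longrightarrow> inv x \<in> \<phi> s" "\<one> \<in> \<phi> s"
  using filter_subgroup[of s]
  by (auto intro: subgroup.mem_carrier subgroup.m_closed subgroup.m_inv_closed subgroup.one_closed)

lemma filter_add: "x \<in> \<phi> (s + t) \<Longrightarrow> x \<in> \<phi> s"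
  using filter_antimono[of s "s + t"] add_mono_preorder[of s s 0 t] by (auto simp: zero_le_all)

lemma filter_zero: "x \<in> \<phi> s \<Longrightarrow> x \<in> \<phi> 0"
  using filter_add[of x 0 s] by simp

lemma commutator_filter: "x \<in> \<phi> s \<Longrightarrow> y \<in> \<phi> t \<Longrightarrow> commutator H x y \<in> \<phi> (s + t)"
  using filter_commutator[of s t] by (auto simp: commutator_subgroup_def intro: generate.incl)

lemma conj_filter:
  assumes "x \<in> \<phi> s" "g \<in> \<phi> t"
  shows "inv g \<otimes> x \<otimes> g \<in> \<phi> s"
  using assms filter_add[OF commutator_filter[OF assms]]
  by (simp add: conj_eq_mult_commutator filter_closed)

lemma gr_kernel_subset: "gr_kernel H \<phi> s \<subseteq> \<phi> s"
proof -
  have "filter_boundary H \<phi> s \<subseteq> \<phi> s"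
    unfolding filter_boundary_def
    by (rule generate_subgroup_incl[OF _ filter_subgroup]) (auto intro: filter_add)
  then show ?thesis by (simp add: gr_kernel_def)
qed

lemma subgroup_gr_kernel: "subgroup (gr_kernel H \<phi> s) H"
  unfolding gr_kernel_def filter_boundary_def
  by (auto intro!: filter_subgroup generate_is_subgroup dest: filter_closed(1))

lemma filter_subset_gr_kernel: "t \<noteq> 0 \<Longrightarrow> x \<in> \<phi> (s + t) \<Longrightarrow> x \<in> gr_kernel H \<phi> s"
  unfolding gr_kernel_def filter_boundary_def
  by (auto intro!: generate.incl filter_zero)

lemma subgroup_gr_kernel_filter_group: "subgroup (gr_kernel H \<phi> s) (filter_group s)"
  by (rule subgroup_incl[OF subgroup_gr_kernel filter_subgroup gr_kernel_subset])

lemma gr_kernel_commutators: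
  assumes "x \<in> carrier (filter_group s)" "y \<in> carrier (filter_group s)"
  shows "commutator (filter_group s) x y \<in> gr_kernel H \<phi> s"
proof -
  have xy: "x \<in> \<phi> s" "y \<in> \<phi> s" using assms by auto
  have "commutator (filter_group s) x y = commutator H x y"
    using xy by (simp add: commutator_def m_inv_consistent[OF filter_subgroup])
  also have "\<dots> \<in> gr_kernel H \<phi> s"
  proof (cases "s = 0")
    case True
    then show ?thesis using commutator_filter[OF xy] by (simp add: gr_kernel_def)
  next
    case False
    then show ?thesis using commutator_filter[OF xy] by (rule filter_subset_gr_kernel)
  qed
  finally show ?thesis .
qed

lemma gr_kernel_normal: "gr_kernel H \<phi> s \<lhd> filter_group s"
  and comm_group_gr: "comm_group (gr H \<phi> s)"
  unfolding gr_def
  by (rule group.commutators_in_subgroup_imp_normal[OF group_filter_group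
        subgroup_gr_kernel_filter_group gr_kernel_commutators]; assumption)+

lemma group_gr: "group (gr H \<phi> s)"
  by (rule comm_group.axioms(2)[OF comm_group_gr])

lemma bar_filter_group: "bar H \<phi> s x = gr_kernel H \<phi> s #>\<^bsub>filter_group s\<^esub> x"
  by (simp add: bar_def r_coset_def)

lemma carrier_gr: "carrier (gr H \<phi> s) = bar H \<phi> s ` \<phi> s"
  by (simp add: gr_def carrier_FactGroup bar_filter_group[abs_def])

lemma bar_hom: "bar H \<phi> s \<in> hom (filter_group s) (gr H \<phi> s)"
  using normal.r_coset_hom_Mod[OF gr_kernel_normal[of s]]
  by (simp add: gr_def bar_filter_group[abs_def])

lemma bar_mult:
  "x \<in> \<phi> s \<Longrightarrow> y \<in> \<phi> s \<Longrightarrow> bar H \<phi> s (x \<otimes> y) = bar H \<phi> s x \<otimes>\<^bsub>gr H \<phi> s\<^esub> bar H \<phi> s y"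
  using hom_mult[OF bar_hom[of s], of x y] by simp

lemma bar_closed: "x \<in> \<phi> s \<Longrightarrow> bar H \<phi> s x \<in> carrier (gr H \<phi> s)"
  by (simp add: carrier_gr)

lemma bar_eq_one: "x \<in> gr_kernel H \<phi> s \<Longrightarrow> bar H \<phi> s x = \<one>\<^bsub>gr H \<phi> s\<^esub>"
  using coset_join2[OF _ subgroup_gr_kernel] subgroup.mem_carrier[OF subgroup_gr_kernel]
  by (simp add: bar_def gr_def)

lemma gr_zero_trivial: "carrier (gr H \<phi> 0) = {\<one>\<^bsub>gr H \<phi> 0\<^esub>}"
  using bar_eq_one[of _ 0] filter_closed(4)[of 0]
  by (auto simp: carrier_gr gr_kernel_def intro!: image_eqI[of _ _ "\<one>"])

text \<open>For \<open>s \<noteq> 0\<close> the denominator of \<open>L\<^sub>s\<close> is generated by the deeper terms, so a homomorphism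
  needs to be tested on those only. This is what makes the pairings below independent of
  representatives.\<close>

lemma hom_trivial_on_gr_kernel:
  assumes J: "group J" and f: "f \<in> hom (filter_group s) J" and s: "s \<noteq> 0"
    and triv: "\<And>t x. t \<noteq> 0 \<Longrightarrow> x \<in> \<phi> (s + t) \<Longrightarrow> f x = \<one>\<^bsub>J\<^esub>"
    and x: "x \<in> gr_kernel H \<phi> s"
  shows "f x = \<one>\<^bsub>J\<^esub>"
proof -
  interpret f: group_hom "filter_group s" J f
    using group_filter_group J f by (simp add: group_hom_def group_hom_axioms_def)
  have "subgroup (kernel (filter_group s) J f) H"
    by (rule incl_subgroup[OF filter_subgroup f.subgroup_kernel])
  moreover have "(\<Union>t\<in>{t. t \<noteq> 0}. \<phi> (s + t)) \<subseteq> kernel (filter_group s) J f"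
    by (auto simp: kernel_def triv filter_add)
  ultimately have "gr_kernel H \<phi> s \<subseteq> kernel (filter_group s) J f"
    using s by (simp add: gr_kernel_def filter_boundary_def generate_subgroup_incl)
  then show ?thesis using x by (auto simp: kernel_def)
qed

abbreviation (input) "LR \<equiv> filter_lie_ring H \<phi>"

lemma filter_lie_ring_simps:
  "carrier LR = carrier (sum_group UNIV (gr H \<phi>))"
  "\<zero>\<^bsub>LR\<^esub> = \<one>\<^bsub>sum_group UNIV (gr H \<phi>)\<^esub>"
  "f \<oplus>\<^bsub>LR\<^esub> g = f \<otimes>\<^bsub>sum_group UNIV (gr H \<phi>)\<^esub> g"
  "f \<otimes>\<^bsub>LR\<^esub> g = gr_bracket H \<phi> f g"
  by (simp_all only: filter_lie_ring_def partial_object.simps monoid.simps ring.simps)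

lemma abelian_group_filter_lie_ring: "abelian_group LR"
proof -
  interpret S: comm_group "sum_group UNIV (gr H \<phi>)"
    by (rule comm_group_sum_group) (rule comm_group_gr)
  show ?thesis
  proof (rule abelian_groupI, unfold filter_lie_ring_simps)
    fix f assume "f \<in> carrier (sum_group UNIV (gr H \<phi>))"
    then show "\<exists>g\<in>carrier (sum_group UNIV (gr H \<phi>)).
        g \<otimes>\<^bsub>sum_group UNIV (gr H \<phi>)\<^esub> f = \<one>\<^bsub>sum_group UNIV (gr H \<phi>)\<^esub>"
      by (intro bexI[of _ "inv\<^bsub>sum_group UNIV (gr H \<phi>)\<^esub> f"] S.l_inv S.inv_closed)
  qed ((rule S.m_closed S.one_closed S.m_assoc S.m_comm S.l_one; assumption?)+)
qed

sublocale L: abelian_group LR by (rule abelian_group_filter_lie_ring)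

lemma hbar_closed: "x \<in> \<phi> s \<Longrightarrow> hbar H \<phi> s x \<in> carrier LR"
  by (auto simp: filter_lie_ring_simps carrier_sum_group_UNIV group_gr hbar_def gr_inclusion_def
      bar_closed group.is_monoid monoid.one_closed)

lemma hbar_mult:
  "x \<in> \<phi> s \<Longrightarrow> y \<in> \<phi> s \<Longrightarrow> hbar H \<phi> s (x \<otimes> y) = hbar H \<phi> s x \<oplus>\<^bsub>LR\<^esub> hbar H \<phi> s y"
  using group.is_monoid[OF group_gr]
  by (auto simp: fun_eq_iff filter_lie_ring_simps hbar_def gr_inclusion_def bar_mult
      monoid.l_one monoid.one_closed)

lemma hbar_eq_zero: "x \<in> gr_kernel H \<phi> s \<Longrightarrow> hbar H \<phi> s x = \<zero>\<^bsub>LR\<^esub>"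
  by (auto simp: fun_eq_iff filter_lie_ring_simps hbar_def gr_inclusion_def bar_eq_one)

lemma hbar_deeper_eq_zero: "t \<noteq> 0 \<Longrightarrow> x \<in> \<phi> (s + t) \<Longrightarrow> hbar H \<phi> s x = \<zero>\<^bsub>LR\<^esub>"
  by (rule hbar_eq_zero) (rule filter_subset_gr_kernel)

lemma hbar_inv:
  assumes x: "x \<in> \<phi> s" shows "hbar H \<phi> s (inv x) = \<ominus>\<^bsub>LR\<^esub> hbar H \<phi> s x"
proof -
  have "hbar H \<phi> s (inv x) \<oplus>\<^bsub>LR\<^esub> hbar H \<phi> s x = hbar H \<phi> s (inv x \<otimes> x)"
    using x by (intro hbar_mult[symmetric] filter_closed)
  also have "\<dots> = \<zero>\<^bsub>LR\<^esub>"
    using x subgroup.one_closed[OF subgroup_gr_kernel]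
    by (simp add: filter_closed hbar_eq_zero)
  finally show ?thesis using x by (simp add: L.minus_equality hbar_closed filter_closed)
qed

text \<open>Conjugation by an element of nonzero degree changes \<open>x\<close> by a commutator of higher degree.\<close>

lemma hbar_conj:
  assumes x: "x \<in> \<phi> s" and g: "g \<in> \<phi> t" and t: "t \<noteq> 0"
  shows "hbar H \<phi> s (inv g \<otimes> x \<otimes> g) = hbar H \<phi> s x"
proof -
  have c: "commutator H x g \<in> \<phi> (s + t)" using x g by (rule commutator_filter)
  show ?thesis
    using x g hbar_deeper_eq_zero[OF t c] filter_add[OF c]
    by (simp add: conj_eq_mult_commutator filter_closed hbar_mult hbar_closed)
qed

lemma hbar_zero_degree: "x \<in> \<phi> 0 \<Longrightarrow> hbar H \<phi> 0 x = \<zero>\<^bsub>LR\<^esub>"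
  by (rule hbar_eq_zero) (simp add: gr_kernel_def)

lemma homogeneous_eq: "homogeneous H \<phi> s = hbar H \<phi> s ` \<phi> s"
  by (simp add: homogeneous_def carrier_gr hbar_def image_image)

text \<open>The Lie ring is generated additively by the classes of nonzero degree, so additive identities
  need to be checked on these classes only.\<close>

lemma filter_lie_ring_induct [consumes 1, case_names zero hbar add]:
  assumes f: "f \<in> carrier LR"
    and zero: "P \<zero>\<^bsub>LR\<^esub>"
    and hbar: "\<And>s x. s \<noteq> 0 \<Longrightarrow> x \<in> \<phi> s \<Longrightarrow> P (hbar H \<phi> s x)"
    and add: "\<And>f g. f \<in> carrier LR \<Longrightarrow> g \<in> carrier LR \<Longrightarrow> P f \<Longrightarrow> P g \<Longrightarrow> P (f \<oplus>\<^bsub>LR\<^esub> g)"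
  shows "P f"
proof (rule sum_group_induct[where L = "gr H \<phi>" and P = P])
  show "P (\<lambda>u. if u = s then U else \<one>\<^bsub>gr H \<phi> u\<^esub>)" if "U \<in> carrier (gr H \<phi> s)" for s U
  proof -
    obtain x where x: "x \<in> \<phi> s" "U = bar H \<phi> s x" using \<open>U \<in> _\<close> by (auto simp: carrier_gr)
    then have "(\<lambda>u. if u = s then U else \<one>\<^bsub>gr H \<phi> u\<^esub>) = hbar H \<phi> s x"
      by (simp add: hbar_def gr_inclusion_def cong: if_cong)
    then show ?thesis using x hbar zero hbar_zero_degree by (cases "s = 0") auto
  qed
qed (use f zero add in \<open>simp_all only: filter_lie_ring_simps group_gr\<close>)

end

text \<open>The formula for the product of two homogeneous classes is wanted in nonzero degrees, but for
  iterated products the degree \<open>s + t\<close> of an inner factor may vanish although \<open>s\<close> and \<open>t\<close> do not.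
  In that case \<open>\<phi>\<^sub>u = \<phi>\<^sub>u\<^sub>+\<^sub>s\<^sub>+\<^sub>t \<subseteq> \<phi>\<^sub>u\<^sub>+\<^sub>s\<close> for every \<open>u\<close>, so the graded ring of
  every filter over this monoid is zero and the formula holds trivially. The degrees below are thus the
  ones for which the formula is available, and unlike the nonzero degrees they are closed under
  addition.\<close>

definition proper_degree :: "'m::comm_monoid_add \<Rightarrow> bool" where
  "proper_degree s \<longleftrightarrow> s \<noteq> 0 \<or> (\<exists>a b::'m. a \<noteq> 0 \<and> b \<noteq> 0 \<and> a + b = 0)"

lemma proper_degree_nonzero: "s \<noteq> 0 \<Longrightarrow> proper_degree s"
  by (simp add: proper_degree_def)

lemma proper_degree_add: "proper_degree s \<Longrightarrow> proper_degree t \<Longrightarrow> proper_degree (s + t)"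
  by (auto simp: proper_degree_def)

lemma (in group_filter) hbar_eq_zero_of_zero_sum:
  fixes a b :: 'm
  assumes "a \<noteq> 0" "b \<noteq> 0" "a + b = 0" "x \<in> \<phi> s"
  shows "hbar H \<phi> s x = \<zero>\<^bsub>filter_lie_ring H \<phi>\<^esub>"
proof (rule hbar_deeper_eq_zero[OF \<open>a \<noteq> 0\<close>], rule filter_add)
  show "x \<in> \<phi> (s + a + b)" using assms by (simp add: add.assoc)
qed

section \<open>Pairings induced by commutation of filters\<close>

text \<open>The commutator in one group and the commutator of a group element with an operator are handled
  alike: the argument \<open>c\<close> is the commutation map, and the union is the single coset of \<open>c x y\<close> as soon
  as that coset does not depend on the representatives.\<close>

definition coset_pairing ::
  "('n, 'x) monoid_scheme \<Rightarrow> ('m::preordered_comm_monoid_add \<Rightarrow> 'n set) \<Rightarrow> ('g \<Rightarrow> 'k \<Rightarrow> 'n) \<Rightarrow>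
    'm \<Rightarrow> 'm \<Rightarrow> 'g set \<Rightarrow> 'k set \<Rightarrow> 'n set" where
  "coset_pairing N \<chi> c s t U V = (\<Union>x\<in>U. \<Union>y\<in>V. bar N \<chi> (s + t) (c x y))"

text \<open>Two filters act on each other by a commutation map into a third one, additive up to terms of higher
  degree. Three instances matter: commutators in the group, commutators in the group of operators, and
  commutators of group elements with operators.\<close>

locale filter_pairing = H: group_filter H \<phi> + K: group_filter K \<psi> + N: group_filter N \<chi>
  for H :: "('g, 'x) monoid_scheme" and \<phi> :: "'m::preordered_comm_monoid_add \<Rightarrow> 'g set"
    and K :: "('k, 'y) monoid_scheme" and \<psi> :: "'m \<Rightarrow> 'k set"
    and N :: "('n, 'z) monoid_scheme" and \<chi> :: "'m \<Rightarrow> 'n set" +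
  fixes c :: "'g \<Rightarrow> 'k \<Rightarrow> 'n"
  assumes c_closed: "x \<in> \<phi> s \<Longrightarrow> y \<in> \<psi> t \<Longrightarrow> c x y \<in> \<chi> (s + t)"
    and c_left: "s \<noteq> 0 \<Longrightarrow> t \<noteq> 0 \<Longrightarrow> x \<in> \<phi> s \<Longrightarrow> x' \<in> \<phi> s \<Longrightarrow> y \<in> \<psi> t \<Longrightarrow>
      bar N \<chi> (s + t) (c (x \<otimes>\<^bsub>H\<^esub> x') y) =
      bar N \<chi> (s + t) (c x y) \<otimes>\<^bsub>gr N \<chi> (s + t)\<^esub> bar N \<chi> (s + t) (c x' y)"
    and c_right: "s \<noteq> 0 \<Longrightarrow> t \<noteq> 0 \<Longrightarrow> x \<in> \<phi> s \<Longrightarrow> y \<in> \<psi> t \<Longrightarrow> y' \<in> \<psi> t \<Longrightarrow>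
      bar N \<chi> (s + t) (c x (y \<otimes>\<^bsub>K\<^esub> y')) =
      bar N \<chi> (s + t) (c x y) \<otimes>\<^bsub>gr N \<chi> (s + t)\<^esub> bar N \<chi> (s + t) (c x y')"
begin

text \<open>Closedness puts \<open>c x y\<close> in \<open>\<chi>\<^sub>s\<^sub>+\<^sub>t\<^sub>+\<^sub>r\<close> for \<open>x \<in> \<phi>\<^sub>s\<^sub>+\<^sub>r\<close>, which lies in the
  denominator of degree \<open>s + t\<close>; the kernel of the homomorphism \<open>x \<mapsto> c x y\<close> then contains the whole
  denominator of degree \<open>s\<close>.\<close>

lemma bar_gr_kernel_left:
  assumes s: "s \<noteq> 0" and t: "t \<noteq> 0" and x: "x \<in> gr_kernel H \<phi> s" and y: "y \<in> \<psi> t"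
  shows "bar N \<chi> (s + t) (c x y) = \<one>\<^bsub>gr N \<chi> (s + t)\<^esub>"
proof (rule H.hom_trivial_on_gr_kernel[OF N.group_gr _ s _ x])
  show "(\<lambda>x. bar N \<chi> (s + t) (c x y)) \<in> hom (H.filter_group s) (gr N \<chi> (s + t))"
    using s t y by (auto simp: hom_def c_left intro: N.bar_closed c_closed)
  show "bar N \<chi> (s + t) (c x y) = \<one>\<^bsub>gr N \<chi> (s + t)\<^esub>" if "r \<noteq> 0" "x \<in> \<phi> (s + r)" for r x
  proof (rule N.bar_eq_one, rule N.filter_subset_gr_kernel[OF \<open>r \<noteq> 0\<close>])
    show "c x y \<in> \<chi> (s + t + r)" using c_closed[OF \<open>x \<in> _\<close> y] by (simp add: ac_simps)
  qed
qed

lemma bar_gr_kernel_right: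
  assumes s: "s \<noteq> 0" and t: "t \<noteq> 0" and x: "x \<in> \<phi> s" and y: "y \<in> gr_kernel K \<psi> t"
  shows "bar N \<chi> (s + t) (c x y) = \<one>\<^bsub>gr N \<chi> (s + t)\<^esub>"
proof (rule K.hom_trivial_on_gr_kernel[OF N.group_gr _ t _ y])
  show "(\<lambda>y. bar N \<chi> (s + t) (c x y)) \<in> hom (K.filter_group t) (gr N \<chi> (s + t))"
    using s t x by (auto simp: hom_def c_right intro: N.bar_closed c_closed)
  show "bar N \<chi> (s + t) (c x y) = \<one>\<^bsub>gr N \<chi> (s + t)\<^esub>" if "r \<noteq> 0" "y \<in> \<psi> (t + r)" for r y
  proof (rule N.bar_eq_one, rule N.filter_subset_gr_kernel[OF \<open>r \<noteq> 0\<close>])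
    show "c x y \<in> \<chi> (s + t + r)" using c_closed[OF x \<open>y \<in> _\<close>] by (simp add: ac_simps)
  qed
qed

lemma coset_pairing_bar:
  assumes s: "s \<noteq> 0" and t: "t \<noteq> 0" and x: "x \<in> \<phi> s" and y: "y \<in> \<psi> t"
  shows "coset_pairing N \<chi> c s t (bar H \<phi> s x) (bar K \<psi> t y) = bar N \<chi> (s + t) (c x y)"
proof -
  interpret gr: group "gr N \<chi> (s + t)" by (rule N.group_gr)
  have eq: "bar N \<chi> (s + t) (c x' y') = bar N \<chi> (s + t) (c x y)"
    if x': "x' \<in> bar H \<phi> s x" and y': "y' \<in> bar K \<psi> t y" for x' y'
  proof -
    obtain k l where k: "k \<in> gr_kernel H \<phi> s" "x' = k \<otimes>\<^bsub>H\<^esub> x"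
      and l: "l \<in> gr_kernel K \<psi> t" "y' = l \<otimes>\<^bsub>K\<^esub> y"
      using x' y' by (auto simp: bar_def r_coset_def)
    have k': "k \<in> \<phi> s" and l': "l \<in> \<psi> t"
      using k l H.gr_kernel_subset K.gr_kernel_subset by auto
    have "bar N \<chi> (s + t) (c x' y') = bar N \<chi> (s + t) (c x y')"
      using s t x y k k' l' l(2) bar_gr_kernel_left[of s t k y']
      by (simp add: c_left K.filter_closed N.bar_closed c_closed)
    also have "\<dots> = bar N \<chi> (s + t) (c x y)"
      using s t x y l l' bar_gr_kernel_right[of s t x l]
      by (simp add: c_right N.bar_closed c_closed)
    finally show ?thesis .
  qed
  have "x \<in> bar H \<phi> s x" "y \<in> bar K \<psi> t y"
    using x y by (auto simp: bar_def H.rcos_self K.rcos_self H.filter_closed K.filter_closed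
        H.subgroup_gr_kernel K.subgroup_gr_kernel)
  moreover have "coset_pairing N \<chi> c s t (bar H \<phi> s x) (bar K \<psi> t y) =
      (\<Union>x'\<in>bar H \<phi> s x. \<Union>y'\<in>bar K \<psi> t y. bar N \<chi> (s + t) (c x y))"
    unfolding coset_pairing_def by (intro SUP_cong refl) (rule eq)
  ultimately show ?thesis by auto
qed

sublocale graded_pairing "gr H \<phi>" "gr K \<psi>" "gr N \<chi>" "coset_pairing N \<chi> c"
proof (rule graded_pairing.intro)
  fix s t :: 'm and U U' V V' assume st: "s \<noteq> 0" "t \<noteq> 0"
  { assume "U \<in> carrier (gr H \<phi> s)" "V \<in> carrier (gr K \<psi> t)"
    with st show "coset_pairing N \<chi> c s t U V \<in> carrier (gr N \<chi> (s + t))"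
      by (auto simp: H.carrier_gr K.carrier_gr coset_pairing_bar N.bar_closed c_closed) }
  { assume "U \<in> carrier (gr H \<phi> s)" "U' \<in> carrier (gr H \<phi> s)" "V \<in> carrier (gr K \<psi> t)"
    with st show "coset_pairing N \<chi> c s t (U \<otimes>\<^bsub>gr H \<phi> s\<^esub> U') V =
      coset_pairing N \<chi> c s t U V \<otimes>\<^bsub>gr N \<chi> (s + t)\<^esub> coset_pairing N \<chi> c s t U' V"
      by (auto simp: H.carrier_gr K.carrier_gr coset_pairing_bar c_left H.filter_closed
          simp flip: H.bar_mult) }
  { assume "U \<in> carrier (gr H \<phi> s)" "V \<in> carrier (gr K \<psi> t)" "V' \<in> carrier (gr K \<psi> t)"
    with st show "coset_pairing N \<chi> c s t U (V \<otimes>\<^bsub>gr K \<psi> t\<^esub> V') =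
      coset_pairing N \<chi> c s t U V \<otimes>\<^bsub>gr N \<chi> (s + t)\<^esub> coset_pairing N \<chi> c s t U V'"
      by (auto simp: H.carrier_gr K.carrier_gr coset_pairing_bar c_right K.filter_closed
          simp flip: K.bar_mult) }
qed (rule H.comm_group_gr K.comm_group_gr N.comm_group_gr H.gr_zero_trivial K.gr_zero_trivial)+

definition pair :: "('m \<Rightarrow> 'g set) \<Rightarrow> ('m \<Rightarrow> 'k set) \<Rightarrow> ('m \<Rightarrow> 'n set)" where
  "pair = graded_product (gr H \<phi>) (gr K \<psi>) (gr N \<chi>) (coset_pairing N \<chi> c)"

lemma pair_closed:
  "f \<in> carrier (filter_lie_ring H \<phi>) \<Longrightarrow> g \<in> carrier (filter_lie_ring K \<psi>) \<Longrightarrow>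
    pair f g \<in> carrier (filter_lie_ring N \<chi>)"
  unfolding pair_def H.filter_lie_ring_simps K.filter_lie_ring_simps N.filter_lie_ring_simps
  by (rule graded_product_closed)

lemma pair_add_left:
  "f \<in> carrier (filter_lie_ring H \<phi>) \<Longrightarrow> f' \<in> carrier (filter_lie_ring H \<phi>) \<Longrightarrow>
    g \<in> carrier (filter_lie_ring K \<psi>) \<Longrightarrow>
    pair (f \<oplus>\<^bsub>filter_lie_ring H \<phi>\<^esub> f') g = pair f g \<oplus>\<^bsub>filter_lie_ring N \<chi>\<^esub> pair f' g"
  unfolding pair_def H.filter_lie_ring_simps K.filter_lie_ring_simps N.filter_lie_ring_simps
  by (rule graded_product_mult_left)

lemma pair_add_right:
  "f \<in> carrier (filter_lie_ring H \<phi>) \<Longrightarrow> g \<in> carrier (filter_lie_ring K \<psi>) \<Longrightarrow>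
    g' \<in> carrier (filter_lie_ring K \<psi>) \<Longrightarrow>
    pair f (g \<oplus>\<^bsub>filter_lie_ring K \<psi>\<^esub> g') = pair f g \<oplus>\<^bsub>filter_lie_ring N \<chi>\<^esub> pair f g'"
  unfolding pair_def H.filter_lie_ring_simps K.filter_lie_ring_simps N.filter_lie_ring_simps
  by (rule graded_product_mult_right)

lemma pair_zero_left:
  assumes "g \<in> carrier (filter_lie_ring K \<psi>)"
  shows "pair \<zero>\<^bsub>filter_lie_ring H \<phi>\<^esub> g = \<zero>\<^bsub>filter_lie_ring N \<chi>\<^esub>"
  using pair_add_left[of "\<zero>\<^bsub>filter_lie_ring H \<phi>\<^esub>" "\<zero>\<^bsub>filter_lie_ring H \<phi>\<^esub>" g] assms
    pair_closed[of "\<zero>\<^bsub>filter_lie_ring H \<phi>\<^esub>" g]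
  by simp

lemma pair_zero_right:
  assumes "f \<in> carrier (filter_lie_ring H \<phi>)"
  shows "pair f \<zero>\<^bsub>filter_lie_ring K \<psi>\<^esub> = \<zero>\<^bsub>filter_lie_ring N \<chi>\<^esub>"
  using pair_add_right[of f "\<zero>\<^bsub>filter_lie_ring K \<psi>\<^esub>" "\<zero>\<^bsub>filter_lie_ring K \<psi>\<^esub>"] assms
    pair_closed[of f "\<zero>\<^bsub>filter_lie_ring K \<psi>\<^esub>"]
  by simp

lemma pair_minus_left:
  assumes "f \<in> carrier (filter_lie_ring H \<phi>)" "g \<in> carrier (filter_lie_ring K \<psi>)"
  shows "pair (\<ominus>\<^bsub>filter_lie_ring H \<phi>\<^esub> f) g = \<ominus>\<^bsub>filter_lie_ring N \<chi>\<^esub> pair f g"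
  using assms pair_add_left[of "\<ominus>\<^bsub>filter_lie_ring H \<phi>\<^esub> f" f g]
  by (simp add: H.L.l_neg pair_zero_left pair_closed N.L.minus_equality)

lemma pair_minus_right:
  assumes "f \<in> carrier (filter_lie_ring H \<phi>)" "g \<in> carrier (filter_lie_ring K \<psi>)"
  shows "pair f (\<ominus>\<^bsub>filter_lie_ring K \<psi>\<^esub> g) = \<ominus>\<^bsub>filter_lie_ring N \<chi>\<^esub> pair f g"
  using assms pair_add_right[of f "\<ominus>\<^bsub>filter_lie_ring K \<psi>\<^esub> g" g]
  by (simp add: K.L.l_neg pair_zero_right pair_closed N.L.minus_equality)

lemma pair_hbar:
  assumes "proper_degree s" "proper_degree t" and x: "x \<in> \<phi> s" and y: "y \<in> \<psi> t"
  shows "pair (hbar H \<phi> s x) (hbar K \<psi> t y) = hbar N \<chi> (s + t) (c x y)"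
proof (cases "s \<noteq> 0 \<and> t \<noteq> 0")
  case True
  then show ?thesis
    using x y
    by (simp add: pair_def hbar_def gr_inclusion_def graded_product_single coset_pairing_bar
        H.bar_closed K.bar_closed cong: if_cong)
next
  case False
  then obtain a b :: 'm where ab: "a \<noteq> 0" "b \<noteq> 0" "a + b = 0"
    using assms by (auto simp: proper_degree_def)
  show ?thesis
    using H.hbar_eq_zero_of_zero_sum[OF ab x] N.hbar_eq_zero_of_zero_sum[OF ab c_closed[OF x y]]
      pair_zero_left[OF K.hbar_closed[OF y]]
    by simp
qed

lemma pair_homogeneous:
  assumes "f \<in> homogeneous H \<phi> s" "g \<in> homogeneous K \<psi> t"
  shows "pair f g \<in> homogeneous N \<chi> (s + t)"
proof -
  obtain x y where x: "x \<in> \<phi> s" "f = hbar H \<phi> s x" and y: "y \<in> \<psi> t" "g = hbar K \<psi> t y"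
    using assms by (auto simp: H.homogeneous_eq K.homogeneous_eq)
  have z: "\<zero>\<^bsub>filter_lie_ring N \<chi>\<^esub> \<in> homogeneous N \<chi> (s + t)"
    unfolding N.homogeneous_eq
    by (rule image_eqI[OF N.hbar_eq_zero[symmetric] N.filter_closed(4)])
       (rule subgroup.one_closed[OF N.subgroup_gr_kernel])
  show ?thesis
  proof (cases "s = 0 \<or> t = 0")
    case True
    then have "pair f g = \<zero>\<^bsub>filter_lie_ring N \<chi>\<^esub>"
      using x y by (auto simp: H.hbar_zero_degree K.hbar_zero_degree pair_zero_left pair_zero_right
          H.hbar_closed K.hbar_closed)
    then show ?thesis using z by simp
  next
    case False
    then have "pair f g = hbar N \<chi> (s + t) (c x y)"
      using x y by (simp add: pair_hbar proper_degree_nonzero)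
    then show ?thesis using c_closed[OF x(1) y(1)] by (simp add: N.homogeneous_eq)
  qed
qed

end

section \<open>Equality of multiadditive maps\<close>

lemma (in group_filter) additive_map_eqI:
  assumes B: "abelian_group B"
    and F: "\<And>f. f \<in> carrier LR \<Longrightarrow> F f \<in> carrier B"
      "\<And>f g. f \<in> carrier LR \<Longrightarrow> g \<in> carrier LR \<Longrightarrow> F (f \<oplus>\<^bsub>LR\<^esub> g) = F f \<oplus>\<^bsub>B\<^esub> F g"
    and F': "\<And>f. f \<in> carrier LR \<Longrightarrow> F' f \<in> carrier B"
      "\<And>f g. f \<in> carrier LR \<Longrightarrow> g \<in> carrier LR \<Longrightarrow> F' (f \<oplus>\<^bsub>LR\<^esub> g) = F' f \<oplus>\<^bsub>B\<^esub> F' g"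
    and eq: "\<And>s x. s \<noteq> 0 \<Longrightarrow> x \<in> \<phi> s \<Longrightarrow> F (hbar H \<phi> s x) = F' (hbar H \<phi> s x)"
    and f: "f \<in> carrier LR"
  shows "F f = F' f"
proof -
  interpret B: abelian_group B by (rule B)
  show ?thesis
    using f
  proof (induction rule: filter_lie_ring_induct)
    case zero
    show ?case
      using F(2)[of "\<zero>\<^bsub>LR\<^esub>" "\<zero>\<^bsub>LR\<^esub>"] F(1)[of "\<zero>\<^bsub>LR\<^esub>"]
        F'(2)[of "\<zero>\<^bsub>LR\<^esub>" "\<zero>\<^bsub>LR\<^esub>"] F'(1)[of "\<zero>\<^bsub>LR\<^esub>"]
      by simp
  qed (simp_all add: eq F F')
qed

text \<open>The Jacobi identity, the Leibniz rule and the compatibility of the derivations with Lie brackets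
  are all equalities of maps that are additive in three arguments.\<close>

definition triadditive ::
  "('a, 'p) ring_scheme \<Rightarrow> ('b, 'q) ring_scheme \<Rightarrow> ('c, 'r) ring_scheme \<Rightarrow> ('d, 's) ring_scheme \<Rightarrow>
    ('a \<Rightarrow> 'b \<Rightarrow> 'c \<Rightarrow> 'd) \<Rightarrow> bool" where
  "triadditive L K M B F \<longleftrightarrow>
    (\<forall>f\<in>carrier L. \<forall>g\<in>carrier K. \<forall>h\<in>carrier M. F f g h \<in> carrier B \<and>
      (\<forall>f'\<in>carrier L. F (f \<oplus>\<^bsub>L\<^esub> f') g h = F f g h \<oplus>\<^bsub>B\<^esub> F f' g h) \<and>
      (\<forall>g'\<in>carrier K. F f (g \<oplus>\<^bsub>K\<^esub> g') h = F f g h \<oplus>\<^bsub>B\<^esub> F f g' h) \<and>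
      (\<forall>h'\<in>carrier M. F f g (h \<oplus>\<^bsub>M\<^esub> h') = F f g h \<oplus>\<^bsub>B\<^esub> F f g h'))"

lemma triadditive_eqI:
  assumes H: "group_filter H \<phi>" and K: "group_filter K \<psi>" and M: "group_filter M \<chi>"
    and B: "abelian_group B"
    and F: "triadditive (filter_lie_ring H \<phi>) (filter_lie_ring K \<psi>) (filter_lie_ring M \<chi>) B F"
    and F': "triadditive (filter_lie_ring H \<phi>) (filter_lie_ring K \<psi>) (filter_lie_ring M \<chi>) B F'"
    and eq: "\<And>s t u x y z. s \<noteq> 0 \<Longrightarrow> t \<noteq> 0 \<Longrightarrow> u \<noteq> 0 \<Longrightarrow> x \<in> \<phi> s \<Longrightarrow> y \<in> \<psi> t \<Longrightarrow> z \<in> \<chi> u \<Longrightarrow>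
      F (hbar H \<phi> s x) (hbar K \<psi> t y) (hbar M \<chi> u z) =
      F' (hbar H \<phi> s x) (hbar K \<psi> t y) (hbar M \<chi> u z)"
    and f: "f \<in> carrier (filter_lie_ring H \<phi>)" and g: "g \<in> carrier (filter_lie_ring K \<psi>)"
    and h: "h \<in> carrier (filter_lie_ring M \<chi>)"
  shows "F f g h = F' f g h"
proof (rule group_filter.additive_map_eqI[OF H B _ _ _ _ _ f])
  fix s x assume s: "s \<noteq> 0" and x: "x \<in> \<phi> s"
  note hx = group_filter.hbar_closed[OF H x]
  show "F (hbar H \<phi> s x) g h = F' (hbar H \<phi> s x) g h"
  proof (rule group_filter.additive_map_eqI[OF K B _ _ _ _ _ g])
    fix t y assume t: "t \<noteq> 0" and y: "y \<in> \<psi> t"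
    note hy = group_filter.hbar_closed[OF K y]
    show "F (hbar H \<phi> s x) (hbar K \<psi> t y) h = F' (hbar H \<phi> s x) (hbar K \<psi> t y) h"
      by (rule group_filter.additive_map_eqI[OF M B _ _ _ _ _ h])
         (use F F' hx hy in \<open>auto simp: triadditive_def eq s t x y\<close>)
  qed (use F F' hx h in \<open>auto simp: triadditive_def\<close>)
qed (use F F' g h in \<open>auto simp: triadditive_def\<close>)

section \<open>The Lie ring of a filter\<close>

context abelian_group begin

lemma add_interchange:
  assumes "a \<in> carrier G" "b \<in> carrier G" "c \<in> carrier G" "d \<in> carrier G"
  shows "(a \<oplus> b) \<oplus> (c \<oplus> d) = (a \<oplus> c) \<oplus> (b \<oplus> d)"
  using assms by (simp add: a_ac)

end

context group_filter begin

text \<open>The correction term in \<open>[x x', y] = [x,y] [[x,y],x'] [x',y]\<close> has degree \<open>s + t + s\<close>, which is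
  deeper than \<open>s + t\<close> because \<open>s \<noteq> 0\<close>; similarly on the right.\<close>

lemma filter_pairing_commutator: "filter_pairing H \<phi> H \<phi> H \<phi> (commutator H)"
proof unfold_locales
  fix s t :: 'm and x x' y y' assume st: "s \<noteq> 0" "t \<noteq> 0"
  interpret gr: comm_group "gr H \<phi> (s + t)" by (rule comm_group_gr)
  { assume x: "x \<in> \<phi> s" "x' \<in> \<phi> s" and y: "y \<in> \<phi> t"
    note c = commutator_filter[OF x(1) y] commutator_filter[OF x(2) y]
    note cc = commutator_filter[OF c(1) x(2)]
    show "bar H \<phi> (s + t) (commutator H (x \<otimes> x') y) =
      bar H \<phi> (s + t) (commutator H x y) \<otimes>\<^bsub>gr H \<phi> (s + t)\<^esub> bar H \<phi> (s + t) (commutator H x' y)"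
      using x y c cc filter_add[OF cc] bar_eq_one[OF filter_subset_gr_kernel[OF st(1) cc]]
      by (simp add: commutator_mult_left filter_closed bar_mult bar_closed) }
  { assume x: "x \<in> \<phi> s" and y: "y \<in> \<phi> t" "y' \<in> \<phi> t"
    note c = commutator_filter[OF x y(1)] commutator_filter[OF x y(2)]
    note cc = commutator_filter[OF c(1) y(2)]
    show "bar H \<phi> (s + t) (commutator H x (y \<otimes> y')) =
      bar H \<phi> (s + t) (commutator H x y) \<otimes>\<^bsub>gr H \<phi> (s + t)\<^esub> bar H \<phi> (s + t) (commutator H x y')"
      using x y c cc filter_add[OF cc] bar_eq_one[OF filter_subset_gr_kernel[OF st(2) cc]]
      by (simp add: commutator_mult_right filter_closed bar_mult bar_closed gr.m_comm) }
qed (rule commutator_filter)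

interpretation br: filter_pairing H \<phi> H \<phi> H \<phi> "commutator H"
  by (rule filter_pairing_commutator)

lemma bracket_eq_pair: "f \<otimes>\<^bsub>LR\<^esub> g = br.pair f g"
  by (simp add: filter_lie_ring_simps br.pair_def graded_product_def gr_bracket_def gr_product_def
      coset_pairing_def fun_eq_iff)

lemma bracket_hbar:
  "proper_degree s \<Longrightarrow> proper_degree t \<Longrightarrow> x \<in> \<phi> s \<Longrightarrow> y \<in> \<phi> t \<Longrightarrow>
    hbar H \<phi> s x \<otimes>\<^bsub>LR\<^esub> hbar H \<phi> t y = hbar H \<phi> (s + t) (commutator H x y)"
  unfolding bracket_eq_pair by (rule br.pair_hbar)

lemma bracket_closed: "f \<in> carrier LR \<Longrightarrow> g \<in> carrier LR \<Longrightarrow> f \<otimes>\<^bsub>LR\<^esub> g \<in> carrier LR"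
  unfolding bracket_eq_pair by (rule br.pair_closed)

lemma bracket_add_left:
  "f \<in> carrier LR \<Longrightarrow> f' \<in> carrier LR \<Longrightarrow> g \<in> carrier LR \<Longrightarrow>
    (f \<oplus>\<^bsub>LR\<^esub> f') \<otimes>\<^bsub>LR\<^esub> g = f \<otimes>\<^bsub>LR\<^esub> g \<oplus>\<^bsub>LR\<^esub> f' \<otimes>\<^bsub>LR\<^esub> g"
  unfolding bracket_eq_pair by (rule br.pair_add_left)

lemma bracket_add_right:
  "f \<in> carrier LR \<Longrightarrow> g \<in> carrier LR \<Longrightarrow> g' \<in> carrier LR \<Longrightarrow>
    f \<otimes>\<^bsub>LR\<^esub> (g \<oplus>\<^bsub>LR\<^esub> g') = f \<otimes>\<^bsub>LR\<^esub> g \<oplus>\<^bsub>LR\<^esub> f \<otimes>\<^bsub>LR\<^esub> g'"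
  unfolding bracket_eq_pair by (rule br.pair_add_right)

lemma bracket_antisym:
  assumes "f \<in> carrier LR" "g \<in> carrier LR"
  shows "f \<otimes>\<^bsub>LR\<^esub> g \<oplus>\<^bsub>LR\<^esub> g \<otimes>\<^bsub>LR\<^esub> f = \<zero>\<^bsub>LR\<^esub>"
proof (rule additive_map_eqI[OF abelian_group_filter_lie_ring, where f = f])
  fix s x assume s: "s \<noteq> 0" and x: "x \<in> \<phi> s"
  note hx = hbar_closed[OF x]
  show "hbar H \<phi> s x \<otimes>\<^bsub>LR\<^esub> g \<oplus>\<^bsub>LR\<^esub> g \<otimes>\<^bsub>LR\<^esub> hbar H \<phi> s x = \<zero>\<^bsub>LR\<^esub>"
  proof (rule additive_map_eqI[OF abelian_group_filter_lie_ring, where f = g])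
    fix t y assume t: "t \<noteq> 0" and y: "y \<in> \<phi> t"
    have "hbar H \<phi> (t + s) (commutator H y x) = \<ominus>\<^bsub>LR\<^esub> hbar H \<phi> (s + t) (commutator H x y)"
      using x y commutator_filter[OF x y]
      by (simp add: filter_closed add.commute flip: hbar_inv inv_commutator[of x y])
    then show "hbar H \<phi> s x \<otimes>\<^bsub>LR\<^esub> hbar H \<phi> t y \<oplus>\<^bsub>LR\<^esub> hbar H \<phi> t y \<otimes>\<^bsub>LR\<^esub> hbar H \<phi> s x = \<zero>\<^bsub>LR\<^esub>"
      using s t x y
      by (simp add: bracket_hbar proper_degree_nonzero hbar_closed commutator_filter L.r_neg)
  qed (use assms hx in \<open>simp_all add: bracket_closed bracket_add_left bracket_add_right L.add_interchange\<close>)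
qed (use assms in \<open>simp_all add: bracket_closed bracket_add_left bracket_add_right L.add_interchange\<close>)

text \<open>Antisymmetry cancels the mixed terms, so vanishing on squares passes from homogeneous elements to
  sums; it does not follow from antisymmetry alone in the presence of 2-torsion.\<close>

lemma bracket_self:
  assumes "f \<in> carrier LR"
  shows "f \<otimes>\<^bsub>LR\<^esub> f = \<zero>\<^bsub>LR\<^esub>"
  using assms
proof (induction rule: filter_lie_ring_induct)
  case zero
  show ?case by (simp add: bracket_eq_pair br.pair_zero_left)
next
  case (hbar s x)
  then show ?case
    by (simp add: bracket_hbar proper_degree_nonzero commutator_self filter_closed hbar_eq_zero
        subgroup.one_closed[OF subgroup_gr_kernel])
next
  case (add f g)
  then show ?case
    by (simp add: bracket_closed bracket_add_left bracket_add_right bracket_antisym)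
qed

text \<open>A factor of the Hall-Witt identity represents the negative of a term of the Jacobi identity,
  because \<open>y\<close> occurs inverted in it.\<close>

lemma hall_witt_term:
  assumes "s \<noteq> 0" "t \<noteq> 0" "u \<noteq> 0" "x \<in> \<phi> s" "y \<in> \<phi> t" "z \<in> \<phi> u"
  shows "hbar H \<phi> (s + t + u) (inv y \<otimes> commutator H (commutator H x (inv y)) z \<otimes> y) =
    \<ominus>\<^bsub>LR\<^esub> ((hbar H \<phi> s x \<otimes>\<^bsub>LR\<^esub> hbar H \<phi> t y) \<otimes>\<^bsub>LR\<^esub> hbar H \<phi> u z)"
    and "inv y \<otimes> commutator H (commutator H x (inv y)) z \<otimes> y \<in> \<phi> (s + t + u)"
proof -
  note y' = filter_closed(3)[OF \<open>y \<in> \<phi> t\<close>]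
  note c = commutator_filter[OF \<open>x \<in> \<phi> s\<close> y']
  note d = commutator_filter[OF c \<open>z \<in> \<phi> u\<close>]
  have "hbar H \<phi> (s + t + u) (inv y \<otimes> commutator H (commutator H x (inv y)) z \<otimes> y) =
    (hbar H \<phi> s x \<otimes>\<^bsub>LR\<^esub> hbar H \<phi> t (inv y)) \<otimes>\<^bsub>LR\<^esub> hbar H \<phi> u z"
    using assms y' c by (simp add: hbar_conj[OF d] bracket_hbar proper_degree_nonzero proper_degree_add)
  then show "hbar H \<phi> (s + t + u) (inv y \<otimes> commutator H (commutator H x (inv y)) z \<otimes> y) =
    \<ominus>\<^bsub>LR\<^esub> ((hbar H \<phi> s x \<otimes>\<^bsub>LR\<^esub> hbar H \<phi> t y) \<otimes>\<^bsub>LR\<^esub> hbar H \<phi> u z)"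
    using assms by (simp add: bracket_eq_pair hbar_inv hbar_closed br.pair_minus_left
        br.pair_minus_right br.pair_closed)
  show "inv y \<otimes> commutator H (commutator H x (inv y)) z \<otimes> y \<in> \<phi> (s + t + u)"
    using d assms by (intro conj_filter)
qed

lemma bracket_jacobi:
  assumes "f \<in> carrier LR" "g \<in> carrier LR" "h \<in> carrier LR"
  shows "(f \<otimes>\<^bsub>LR\<^esub> g) \<otimes>\<^bsub>LR\<^esub> h \<oplus>\<^bsub>LR\<^esub> (g \<otimes>\<^bsub>LR\<^esub> h) \<otimes>\<^bsub>LR\<^esub> f \<oplus>\<^bsub>LR\<^esub> (h \<otimes>\<^bsub>LR\<^esub> f) \<otimes>\<^bsub>LR\<^esub> g = \<zero>\<^bsub>LR\<^esub>"
proof (rule triadditive_eqI[OF group_filter_axioms group_filter_axioms group_filter_axioms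
      abelian_group_filter_lie_ring _ _ _ assms, where F' = "\<lambda>_ _ _. \<zero>\<^bsub>LR\<^esub>"])
  show "triadditive LR LR LR LR (\<lambda>f g h. (f \<otimes>\<^bsub>LR\<^esub> g) \<otimes>\<^bsub>LR\<^esub> h \<oplus>\<^bsub>LR\<^esub> (g \<otimes>\<^bsub>LR\<^esub> h) \<otimes>\<^bsub>LR\<^esub> f \<oplus>\<^bsub>LR\<^esub> (h \<otimes>\<^bsub>LR\<^esub> f) \<otimes>\<^bsub>LR\<^esub> g)"
    by (simp add: triadditive_def bracket_closed bracket_add_left bracket_add_right L.a_ac)
  show "triadditive LR LR LR LR (\<lambda>_ _ _. \<zero>\<^bsub>LR\<^esub>)"
    by (simp add: triadditive_def)
  fix s t u x y z
  assume s: "s \<noteq> 0" and t: "t \<noteq> 0" and u: "u \<noteq> 0" and x: "x \<in> \<phi> s" and y: "y \<in> \<phi> t" and z: "z \<in> \<phi> u"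
  let ?x = "hbar H \<phi> s x" and ?y = "hbar H \<phi> t y" and ?z = "hbar H \<phi> u z"
  let ?J = "(?x \<otimes>\<^bsub>LR\<^esub> ?y) \<otimes>\<^bsub>LR\<^esub> ?z \<oplus>\<^bsub>LR\<^esub> (?y \<otimes>\<^bsub>LR\<^esub> ?z) \<otimes>\<^bsub>LR\<^esub> ?x \<oplus>\<^bsub>LR\<^esub> (?z \<otimes>\<^bsub>LR\<^esub> ?x) \<otimes>\<^bsub>LR\<^esub> ?y"
  let ?a = "inv y \<otimes> commutator H (commutator H x (inv y)) z \<otimes> y"
    and ?b = "inv z \<otimes> commutator H (commutator H y (inv z)) x \<otimes> z"
    and ?c = "inv x \<otimes> commutator H (commutator H z (inv x)) y \<otimes> x"
  have deg: "t + u + s = s + t + u" "u + s + t = s + t + u" by (simp_all add: ac_simps)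
  note terms = hall_witt_term[OF s t u x y z] hall_witt_term[OF t u s y z x, unfolded deg]
    hall_witt_term[OF u s t z x y, unfolded deg]
  note closed = hbar_closed[OF x] hbar_closed[OF y] hbar_closed[OF z]
  have "\<zero>\<^bsub>LR\<^esub> = hbar H \<phi> (s + t + u) (?a \<otimes> (?b \<otimes> ?c))"
    unfolding hall_witt[OF x[THEN filter_closed(1)] y[THEN filter_closed(1)] z[THEN filter_closed(1)]]
    by (rule hbar_eq_zero[symmetric]) (rule subgroup.one_closed[OF subgroup_gr_kernel])
  also have "\<dots> = \<ominus>\<^bsub>LR\<^esub> ((?x \<otimes>\<^bsub>LR\<^esub> ?y) \<otimes>\<^bsub>LR\<^esub> ?z) \<oplus>\<^bsub>LR\<^esub>
      (\<ominus>\<^bsub>LR\<^esub> ((?y \<otimes>\<^bsub>LR\<^esub> ?z) \<otimes>\<^bsub>LR\<^esub> ?x) \<oplus>\<^bsub>LR\<^esub> \<ominus>\<^bsub>LR\<^esub> ((?z \<otimes>\<^bsub>LR\<^esub> ?x) \<otimes>\<^bsub>LR\<^esub> ?y))"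
    by (simp only: hbar_mult filter_closed(2) terms)
  also have "\<dots> = \<ominus>\<^bsub>LR\<^esub> ?J"
    using closed by (simp add: bracket_closed L.minus_add L.a_assoc)
  finally show "?J = \<zero>\<^bsub>LR\<^esub>"
    using closed L.r_neg[of ?J] by (simp add: bracket_closed)
qed

lemma lie_ring_filter_lie_ring: "lie_ring LR"
  by (intro lie_ring.intro lie_ring_axioms.intro abelian_group_filter_lie_ring bracket_closed
      bracket_add_left bracket_add_right bracket_self bracket_jacobi)

end

section \<open>The Lie ring of derivations\<close>

context lie_ring begin

lemma derivationD:
  assumes "derivation L D"
  shows "u \<in> carrier L \<Longrightarrow> D u \<in> carrier L" "D \<in> extensional (carrier L)"
    and "u \<in> carrier L \<Longrightarrow> v \<in> carrier L \<Longrightarrow> D (u \<oplus> v) = D u \<oplus> D v"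
    and "u \<in> carrier L \<Longrightarrow> v \<in> carrier L \<Longrightarrow> D (u \<otimes> v) = (D u \<otimes> v) \<oplus> (u \<otimes> D v)"
  using assms by (auto simp: derivation_def PiE_iff)

lemma derivation_zero:
  assumes "derivation L D" shows "D \<zero> = \<zero>"
  using derivationD(1)[OF assms, of \<zero>] derivationD(3)[OF assms, of \<zero> \<zero>] by simp

lemma derivation_minus:
  assumes D: "derivation L D" and "u \<in> carrier L" "v \<in> carrier L"
  shows "D (u \<ominus> v) = D u \<ominus> D v"
proof -
  have "D (\<ominus> v) \<oplus> D v = \<zero>"
    using assms derivationD(3)[OF D, of "\<ominus> v" v] by (simp add: l_neg derivation_zero)
  then have "D (\<ominus> v) = \<ominus> D v" using assms by (simp add: minus_equality derivationD(1))
  then show ?thesis using assms by (simp add: minus_eq derivationD(3))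
qed

lemma lie_zero:
  "u \<in> carrier L \<Longrightarrow> \<zero> \<otimes> u = \<zero>" "u \<in> carrier L \<Longrightarrow> u \<otimes> \<zero> = \<zero>"
  using lie_l_distr[of \<zero> \<zero> u] lie_closed[of \<zero> u] lie_r_distr[of \<zero> \<zero> u] lie_closed[of u \<zero>] by simp_all

lemma lie_minus_left:
  assumes "u \<in> carrier L" "v \<in> carrier L" shows "(\<ominus> u) \<otimes> v = \<ominus> (u \<otimes> v)"
  using assms lie_l_distr[of "\<ominus> u" u v] by (simp add: l_neg lie_zero minus_equality lie_closed)

lemma lie_minus_right:
  assumes "u \<in> carrier L" "v \<in> carrier L" shows "u \<otimes> (\<ominus> v) = \<ominus> (u \<otimes> v)"
  using assms lie_r_distr[of "\<ominus> v" v u] by (simp add: l_neg lie_zero minus_equality lie_closed)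

lemma derivationI:
  assumes "\<And>u. u \<in> carrier L \<Longrightarrow> D u \<in> carrier L" "D \<in> extensional (carrier L)"
    and "\<And>u v. u \<in> carrier L \<Longrightarrow> v \<in> carrier L \<Longrightarrow> D (u \<oplus> v) = D u \<oplus> D v"
    and "\<And>u v. u \<in> carrier L \<Longrightarrow> v \<in> carrier L \<Longrightarrow> D (u \<otimes> v) = (D u \<otimes> v) \<oplus> (u \<otimes> D v)"
  shows "derivation L D"
  using assms by (auto simp: derivation_def PiE_iff)

lemma derivation_eqI:
  assumes "derivation L D" "derivation L E" "\<And>u. u \<in> carrier L \<Longrightarrow> D u = E u"
  shows "D = E"
  using assms by (meson derivationD(2) extensionalityI)

lemma Der_simps:
  "carrier (Der L) = {D. derivation L D}"
  "\<zero>\<^bsub>Der L\<^esub> = (\<lambda>u\<in>carrier L. \<zero>)"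
  "D \<oplus>\<^bsub>Der L\<^esub> E = (\<lambda>u\<in>carrier L. D u \<oplus> E u)"
  "D \<otimes>\<^bsub>Der L\<^esub> E = (\<lambda>u\<in>carrier L. E (D u) \<ominus> D (E u))"
  by (simp_all add: Der_def)

lemma derivation_Der_zero: "derivation L \<zero>\<^bsub>Der L\<^esub>"
  by (rule derivationI) (simp_all add: Der_simps lie_closed lie_zero)

lemma derivation_Der_add:
  assumes "derivation L D" "derivation L E" shows "derivation L (D \<oplus>\<^bsub>Der L\<^esub> E)"
  by (rule derivationI)
     (use assms in \<open>simp_all add: Der_simps derivationD lie_closed lie_l_distr lie_r_distr add_interchange\<close>)

lemma derivation_uminus:
  assumes "derivation L D" shows "derivation L (\<lambda>u\<in>carrier L. \<ominus> D u)"
  by (rule derivationI)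
     (use assms in \<open>simp_all add: derivationD lie_closed lie_minus_left lie_minus_right minus_add\<close>)

text \<open>In \<open>(u v)DE - (u v)ED\<close> the mixed products \<open>(uD)(vE)\<close> and \<open>(uE)(vD)\<close> cancel.\<close>

lemma minus_cancel_middle:
  assumes "a \<in> carrier L" "b \<in> carrier L" "c \<in> carrier L" "d \<in> carrier L"
    "a' \<in> carrier L" "d' \<in> carrier L"
  shows "((a \<oplus> b) \<oplus> (c \<oplus> d)) \<ominus> ((a' \<oplus> c) \<oplus> (b \<oplus> d')) = (a \<ominus> a') \<oplus> (d \<ominus> d')"
proof -
  have "((a \<oplus> b) \<oplus> (c \<oplus> d)) \<ominus> ((a' \<oplus> c) \<oplus> (b \<oplus> d')) =
      ((a \<oplus> \<ominus> a') \<oplus> (d \<oplus> \<ominus> d')) \<oplus> ((b \<oplus> \<ominus> b) \<oplus> (c \<oplus> \<ominus> c))"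
    using assms by (simp only: minus_eq minus_add a_ac a_inv_closed a_closed)
  then show ?thesis using assms by (simp add: r_neg minus_eq)
qed

text \<open>The letters are the six compositions of three derivations.\<close>

lemma jacobi_cancel:
  assumes "a \<in> carrier L" "b \<in> carrier L" "c \<in> carrier L" "d \<in> carrier L"
    "e \<in> carrier L" "f \<in> carrier L"
  shows "((a \<ominus> b) \<ominus> (c \<ominus> d)) \<oplus> ((e \<ominus> d) \<ominus> (a \<ominus> f)) \<oplus> ((c \<ominus> f) \<ominus> (e \<ominus> b)) = \<zero>"
proof -
  have "((a \<ominus> b) \<ominus> (c \<ominus> d)) \<oplus> ((e \<ominus> d) \<ominus> (a \<ominus> f)) \<oplus> ((c \<ominus> f) \<ominus> (e \<ominus> b)) =
    (a \<oplus> \<ominus> a) \<oplus> (b \<oplus> \<ominus> b) \<oplus> (c \<oplus> \<ominus> c) \<oplus> (d \<oplus> \<ominus> d) \<oplus> (e \<oplus> \<ominus> e) \<oplus> (f \<oplus> \<ominus> f)"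
    using assms by (simp only: minus_eq minus_add minus_minus a_ac a_inv_closed a_closed)
  then show ?thesis using assms by (simp add: r_neg)
qed

lemma derivation_Der_lie:
  assumes D: "derivation L D" and E: "derivation L E" shows "derivation L (D \<otimes>\<^bsub>Der L\<^esub> E)"
proof (rule derivationI)
  note DE = derivationD[OF D] derivationD[OF E]
  fix u v assume uv: "u \<in> carrier L" "v \<in> carrier L"
  show "(D \<otimes>\<^bsub>Der L\<^esub> E) (u \<oplus> v) = (D \<otimes>\<^bsub>Der L\<^esub> E) u \<oplus> (D \<otimes>\<^bsub>Der L\<^esub> E) v"
    using uv by (simp add: Der_simps DE minus_eq minus_add add_interchange)
  have "(D \<otimes>\<^bsub>Der L\<^esub> E) (u \<otimes> v) =
    ((E (D u) \<otimes> v \<oplus> D u \<otimes> E v) \<oplus> (E u \<otimes> D v \<oplus> u \<otimes> E (D v))) \<ominus>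
    ((D (E u) \<otimes> v \<oplus> E u \<otimes> D v) \<oplus> (D u \<otimes> E v \<oplus> u \<otimes> D (E v)))"
    using uv by (simp add: Der_simps DE lie_closed)
  also have "\<dots> = (E (D u) \<otimes> v \<ominus> D (E u) \<otimes> v) \<oplus> (u \<otimes> E (D v) \<ominus> u \<otimes> D (E v))"
    using uv by (intro minus_cancel_middle lie_closed DE)
  also have "\<dots> = ((D \<otimes>\<^bsub>Der L\<^esub> E) u \<otimes> v) \<oplus> (u \<otimes> (D \<otimes>\<^bsub>Der L\<^esub> E) v)"
    using uv by (simp add: Der_simps DE minus_eq lie_l_distr lie_r_distr lie_minus_left lie_minus_right lie_closed)
  finally show "(D \<otimes>\<^bsub>Der L\<^esub> E) (u \<otimes> v) = ((D \<otimes>\<^bsub>Der L\<^esub> E) u \<otimes> v) \<oplus> (u \<otimes> (D \<otimes>\<^bsub>Der L\<^esub> E) v)" .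
qed (use assms in \<open>simp_all add: Der_simps derivationD\<close>)

lemma abelian_group_Der: "abelian_group (Der L)"
proof (rule abelian_groupI)
  fix D E F assume D: "D \<in> carrier (Der L)" and E: "E \<in> carrier (Der L)" and F: "F \<in> carrier (Der L)"
  note d = D[unfolded Der_simps mem_Collect_eq] E[unfolded Der_simps mem_Collect_eq]
    F[unfolded Der_simps mem_Collect_eq]
  show "(D \<oplus>\<^bsub>Der L\<^esub> E) \<oplus>\<^bsub>Der L\<^esub> F = D \<oplus>\<^bsub>Der L\<^esub> (E \<oplus>\<^bsub>Der L\<^esub> F)"
    using d by (auto simp: Der_simps derivationD a_assoc intro!: restrict_ext)
next
  fix D E assume D: "D \<in> carrier (Der L)" and E: "E \<in> carrier (Der L)"
  note d = D[unfolded Der_simps mem_Collect_eq] E[unfolded Der_simps mem_Collect_eq]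
  show "D \<oplus>\<^bsub>Der L\<^esub> E \<in> carrier (Der L)"
    using derivation_Der_add[OF d] by (simp add: Der_simps(1))
  show "D \<oplus>\<^bsub>Der L\<^esub> E = E \<oplus>\<^bsub>Der L\<^esub> D"
    using d by (auto simp: Der_simps derivationD a_comm intro!: restrict_ext)
  show "\<zero>\<^bsub>Der L\<^esub> \<oplus>\<^bsub>Der L\<^esub> D = D"
    by (rule derivation_eqI[OF derivation_Der_add[OF derivation_Der_zero d(1)] d(1)])
       (use d in \<open>simp add: Der_simps derivationD\<close>)
  show "\<exists>E\<in>carrier (Der L). E \<oplus>\<^bsub>Der L\<^esub> D = \<zero>\<^bsub>Der L\<^esub>"
    using d derivation_uminus[OF d(1)]
    by (intro bexI[of _ "\<lambda>u\<in>carrier L. \<ominus> D u"])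
       (auto simp: Der_simps derivationD l_neg intro!: restrict_ext)
next
  show "\<zero>\<^bsub>Der L\<^esub> \<in> carrier (Der L)"
    using derivation_Der_zero by (simp add: Der_simps(1))
qed

lemma lie_ring_Der: "lie_ring (Der L)"
proof (intro lie_ring.intro lie_ring_axioms.intro abelian_group_Der)
  fix D E F assume D: "D \<in> carrier (Der L)" and E: "E \<in> carrier (Der L)" and F: "F \<in> carrier (Der L)"
  note d = D[unfolded Der_simps mem_Collect_eq] E[unfolded Der_simps mem_Collect_eq]
    F[unfolded Der_simps mem_Collect_eq]
  show "(D \<oplus>\<^bsub>Der L\<^esub> E) \<otimes>\<^bsub>Der L\<^esub> F = (D \<otimes>\<^bsub>Der L\<^esub> F) \<oplus>\<^bsub>Der L\<^esub> (E \<otimes>\<^bsub>Der L\<^esub> F)"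
    "F \<otimes>\<^bsub>Der L\<^esub> (D \<oplus>\<^bsub>Der L\<^esub> E) = (F \<otimes>\<^bsub>Der L\<^esub> D) \<oplus>\<^bsub>Der L\<^esub> (F \<otimes>\<^bsub>Der L\<^esub> E)"
    using d by (auto simp: Der_simps derivationD minus_eq minus_add add_interchange intro!: restrict_ext)
  show "((D \<otimes>\<^bsub>Der L\<^esub> E) \<otimes>\<^bsub>Der L\<^esub> F) \<oplus>\<^bsub>Der L\<^esub> ((E \<otimes>\<^bsub>Der L\<^esub> F) \<otimes>\<^bsub>Der L\<^esub> D) \<oplus>\<^bsub>Der L\<^esub>
      ((F \<otimes>\<^bsub>Der L\<^esub> D) \<otimes>\<^bsub>Der L\<^esub> E) = \<zero>\<^bsub>Der L\<^esub>"
    using d by (auto simp: Der_simps derivationD derivation_minus intro!: restrict_ext jacobi_cancel)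
next
  fix D E assume D: "D \<in> carrier (Der L)" and E: "E \<in> carrier (Der L)"
  note d = D[unfolded Der_simps mem_Collect_eq] E[unfolded Der_simps mem_Collect_eq]
  show "D \<otimes>\<^bsub>Der L\<^esub> E \<in> carrier (Der L)"
    using derivation_Der_lie[OF d] by (simp add: Der_simps(1))
  show "D \<otimes>\<^bsub>Der L\<^esub> D = \<zero>\<^bsub>Der L\<^esub>"
    using d by (auto simp: Der_simps derivationD minus_eq r_neg intro!: restrict_ext)
qed

end

section \<open>The filter on the group of operators\<close>

locale filter_action = group_filter G \<phi> + A: group A
  for G :: "('g, 'x) monoid_scheme" (structure)
    and \<phi> :: "'m::preordered_comm_monoid_add \<Rightarrow> 'g set"
    and A :: "('a, 'y) monoid_scheme" and \<theta> :: "'a \<Rightarrow> 'g \<Rightarrow> 'g" +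
  assumes action_hom: "\<theta> \<in> hom A (right_AutoGroup G)"
    and action_invariant: "invariant_under A \<theta> (\<phi> s)"
begin

abbreviation act_comm :: "'g \<Rightarrow> 'a \<Rightarrow> 'g" where "act_comm \<equiv> act_commutator G \<theta>"
abbreviation \<Delta> :: "'m \<Rightarrow> 'a set" where "\<Delta> \<equiv> filter_Delta A G \<theta> \<phi>"

lemma action_auto: "a \<in> carrier A \<Longrightarrow> \<theta> a \<in> auto G"
  using action_hom by (auto simp: hom_def right_AutoGroup_def AutoGroup_def)

lemma action_closed: "a \<in> carrier A \<Longrightarrow> x \<in> carrier G \<Longrightarrow> \<theta> a x \<in> carrier G"
  using action_auto[of a] by (auto simp: auto_def hom_def)

lemma action_mult:
  "a \<in> carrier A \<Longrightarrow> x \<in> carrier G \<Longrightarrow> y \<in> carrier G \<Longrightarrow> \<theta> a (x \<otimes> y) = \<theta> a x \<otimes> \<theta> a y"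
  using action_auto[of a] by (auto simp: auto_def hom_def)

lemma action_inv:
  assumes "a \<in> carrier A" "x \<in> carrier G" shows "\<theta> a (inv x) = inv (\<theta> a x)"
proof -
  have "group_hom G G (\<theta> a)"
    using action_auto[of a] assms by (auto simp: auto_def group_hom_def group_hom_axioms_def)
  then show ?thesis using assms by (simp add: group_hom.hom_inv)
qed

lemma action_comp:
  assumes "a \<in> carrier A" "b \<in> carrier A" "x \<in> carrier G"
  shows "\<theta> (a \<otimes>\<^bsub>A\<^esub> b) x = \<theta> b (\<theta> a x)"
proof -
  have "\<theta> (a \<otimes>\<^bsub>A\<^esub> b) = compose (carrier G) (\<theta> b) (\<theta> a)"
    using hom_mult[OF action_hom assms(1,2)] action_auto[OF assms(1)] action_auto[OF assms(2)]
    by (simp add: right_AutoGroup_def AutoGroup_def BijGroup_def auto_def)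
  then show ?thesis using assms by (simp add: compose_eq)
qed

lemma action_one:
  assumes "x \<in> carrier G" shows "\<theta> \<one>\<^bsub>A\<^esub> x = x"
proof -
  have "inj_on (\<theta> \<one>\<^bsub>A\<^esub>) (carrier G)"
    using action_auto[of "\<one>\<^bsub>A\<^esub>"] by (auto simp: auto_def Bij_def bij_betw_def)
  moreover have "\<theta> \<one>\<^bsub>A\<^esub> (\<theta> \<one>\<^bsub>A\<^esub> x) = \<theta> \<one>\<^bsub>A\<^esub> x"
    using action_comp[of "\<one>\<^bsub>A\<^esub>" "\<one>\<^bsub>A\<^esub>" x] assms by simp
  ultimately show ?thesis using assms by (auto simp: action_closed dest: inj_onD)
qed

lemma action_filter: "a \<in> carrier A \<Longrightarrow> x \<in> \<phi> s \<Longrightarrow> \<theta> a x \<in> \<phi> s"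
  using action_invariant by (auto simp: invariant_under_def)

lemma action_inv_cancel:
  "a \<in> carrier A \<Longrightarrow> x \<in> carrier G \<Longrightarrow> \<theta> a (\<theta> (inv\<^bsub>A\<^esub> a) x) = x"
  by (simp flip: action_comp add: action_one)

lemmas action_simps = action_closed action_mult action_inv action_comp act_commutator_def

lemma action_eq: "a \<in> carrier A \<Longrightarrow> x \<in> carrier G \<Longrightarrow> \<theta> a x = x \<otimes> act_comm x a"
  by (simp add: action_simps word_simps)

lemma act_comm_mult_left:
  assumes "a \<in> carrier A" "x \<in> carrier G" "y \<in> carrier G"
  shows "act_comm (x \<otimes> y) a = act_comm x a \<otimes> (commutator G (act_comm x a) y \<otimes> act_comm y a)"
  using assms by (simp add: action_simps word_simps commutator_def)

lemma act_comm_mult_right: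
  assumes "a \<in> carrier A" "b \<in> carrier A" "x \<in> carrier G"
  shows "act_comm x (a \<otimes>\<^bsub>A\<^esub> b) = act_comm x b \<otimes> (act_comm x a \<otimes> act_comm (act_comm x a) b)"
  using assms by (simp add: action_simps word_simps)

lemma act_comm_inv:
  assumes "a \<in> carrier A" "x \<in> carrier G"
  shows "act_comm x (inv\<^bsub>A\<^esub> a) = inv (act_comm (\<theta> (inv\<^bsub>A\<^esub> a) x) a)"
  using assms action_inv_cancel[OF assms] by (simp add: act_commutator_def action_closed word_simps)

text \<open>Since \<open>ba [a,b] = ab\<close>, this compares \<open>y\<^sup>a\<^sup>b = y [y,b] [y,a] [[y,a],b]\<close> with \<open>y\<^sup>b\<^sup>a\<close>. It does the
  work of the three subgroups lemma for \<open>[\<Delta>\<^sub>s, \<Delta>\<^sub>t] \<subseteq> \<Delta>\<^sub>s\<^sub>+\<^sub>t\<close>, and it also keeps track of the exact terms,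
  which show that the class of \<open>[a,b]\<close> acts as the Lie bracket of the derivations of \<open>a\<close> and \<open>b\<close>.\<close>

lemma act_comm_commutator:
  assumes a: "a \<in> carrier A" and b: "b \<in> carrier A" and y: "y \<in> carrier G"
  shows "act_comm (\<theta> (b \<otimes>\<^bsub>A\<^esub> a) y) (commutator A a b) =
    inv (act_comm (act_comm y b) a) \<otimes>
    (commutator G (act_comm y b) (act_comm y a) \<otimes> act_comm (act_comm y a) b)"
proof -
  have "(b \<otimes>\<^bsub>A\<^esub> a) \<otimes>\<^bsub>A\<^esub> commutator A a b = a \<otimes>\<^bsub>A\<^esub> b"
    using a b by (simp add: commutator_def A.word_simps)
  then have "\<theta> (commutator A a b) (\<theta> (b \<otimes>\<^bsub>A\<^esub> a) y) = \<theta> (a \<otimes>\<^bsub>A\<^esub> b) y"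
    using a b y by (simp flip: action_comp add: A.commutator_closed)
  then have "act_comm (\<theta> (b \<otimes>\<^bsub>A\<^esub> a) y) (commutator A a b) =
      inv (\<theta> (b \<otimes>\<^bsub>A\<^esub> a) y) \<otimes> \<theta> (a \<otimes>\<^bsub>A\<^esub> b) y"
    by (simp add: act_commutator_def)
  then show ?thesis using a b y by (simp add: action_simps word_simps commutator_def)
qed

lemma act_comm_commutator_left:
  assumes "a \<in> carrier A" "x \<in> carrier G" "y \<in> carrier G"
  shows "act_comm (commutator G x y) a =
    inv (commutator G x y) \<otimes> commutator G (x \<otimes> act_comm x a) (y \<otimes> act_comm y a)"
proof -
  have "\<theta> a (commutator G x y) = commutator G (\<theta> a x) (\<theta> a y)"
    using assms by (simp add: commutator_def action_simps)
  then show ?thesis using assms by (simp add: act_commutator_def action_closed word_simps)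
qed

lemma Delta_iff:
  "a \<in> \<Delta> s \<longleftrightarrow> a \<in> carrier A \<and> (\<forall>t. \<forall>x\<in>\<phi> t. act_comm x a \<in> \<phi> (t + s))"
proof -
  have "act_commutator_subgroup G \<theta> (\<phi> t) a \<subseteq> \<phi> (t + s) \<longleftrightarrow> (\<forall>x\<in>\<phi> t. act_comm x a \<in> \<phi> (t + s))" for t
    unfolding act_commutator_subgroup_def
    using generate_subgroup_incl[OF _ filter_subgroup[of "t + s"]]
      generate.incl[of _ "{act_comm x a |x. x \<in> \<phi> t}" G]
    by (smt (verit) mem_Collect_eq subset_iff)
  then show ?thesis by (simp add: filter_Delta_def)
qed

lemma Delta_carrier: "a \<in> \<Delta> s \<Longrightarrow> a \<in> carrier A"
  by (simp add: Delta_iff)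

lemma act_comm_filter: "x \<in> \<phi> t \<Longrightarrow> a \<in> \<Delta> s \<Longrightarrow> act_comm x a \<in> \<phi> (t + s)"
  by (simp add: Delta_iff)

lemma subgroup_Delta: "subgroup (\<Delta> s) A"
proof (rule subgroup.intro)
  show "\<Delta> s \<subseteq> carrier A" by (auto dest: Delta_carrier)
  show "\<one>\<^bsub>A\<^esub> \<in> \<Delta> s"
    by (simp add: Delta_iff act_commutator_def action_one filter_closed)
  fix a b assume a: "a \<in> \<Delta> s" and b: "b \<in> \<Delta> s"
  note ab = Delta_carrier[OF a] Delta_carrier[OF b]
  show "a \<otimes>\<^bsub>A\<^esub> b \<in> \<Delta> s"
    unfolding Delta_iff
  proof (intro conjI allI ballI)
    fix t x assume x: "x \<in> \<phi> t"
    note xa = act_comm_filter[OF x a] and xb = act_comm_filter[OF x b]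
    have "act_comm x (a \<otimes>\<^bsub>A\<^esub> b) = act_comm x b \<otimes> \<theta> b (act_comm x a)"
      using ab x xa by (simp add: act_comm_mult_right filter_closed action_eq[of b "act_comm x a"])
    then show "act_comm x (a \<otimes>\<^bsub>A\<^esub> b) \<in> \<phi> (t + s)"
      using ab xa xb by (simp add: filter_closed action_filter)
  qed (use ab in simp)
  show "inv\<^bsub>A\<^esub> a \<in> \<Delta> s"
    unfolding Delta_iff
    using ab a by (auto simp: act_comm_inv filter_closed action_filter act_comm_filter)
qed

text \<open>The identity above is available at \<open>x = y\<^sup>b\<^sup>a\<close>. The preimage \<open>y\<close> stays in \<open>\<phi>\<^sub>u\<close> by invariance,
  and the middle commutator is deeper than the other two by \<open>u\<close>.\<close>

lemma act_comm_commutator_filter: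
  assumes x: "x \<in> \<phi> u" and a: "a \<in> \<Delta> s" and b: "b \<in> \<Delta> t"
  obtains y where "y = \<theta> (inv\<^bsub>A\<^esub> (b \<otimes>\<^bsub>A\<^esub> a)) x" "y \<in> \<phi> u"
    "act_comm (act_comm y b) a \<in> \<phi> (u + (s + t))"
    "commutator G (act_comm y b) (act_comm y a) \<in> \<phi> (u + (s + t) + u)"
    "act_comm (act_comm y a) b \<in> \<phi> (u + (s + t))"
    "act_comm x (commutator A a b) = inv (act_comm (act_comm y b) a) \<otimes>
      (commutator G (act_comm y b) (act_comm y a) \<otimes> act_comm (act_comm y a) b)"
proof
  note ab = Delta_carrier[OF a] Delta_carrier[OF b]
  let ?y = "\<theta> (inv\<^bsub>A\<^esub> (b \<otimes>\<^bsub>A\<^esub> a)) x"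
  show y: "?y \<in> \<phi> u" using ab x by (simp add: action_filter)
  note ya = act_comm_filter[OF y a] and yb = act_comm_filter[OF y b]
  show "act_comm (act_comm ?y b) a \<in> \<phi> (u + (s + t))"
    using act_comm_filter[OF yb a] by (simp add: ac_simps)
  show "commutator G (act_comm ?y b) (act_comm ?y a) \<in> \<phi> (u + (s + t) + u)"
    using commutator_filter[OF yb ya] by (simp add: ac_simps)
  show "act_comm (act_comm ?y a) b \<in> \<phi> (u + (s + t))"
    using act_comm_filter[OF ya b] by (simp add: ac_simps)
  show "act_comm x (commutator A a b) = inv (act_comm (act_comm ?y b) a) \<otimes>
      (commutator G (act_comm ?y b) (act_comm ?y a) \<otimes> act_comm (act_comm ?y a) b)"
    using act_comm_commutator[of a b ?y] ab x y by (simp only: A.m_closed action_inv_cancel filter_closed)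
qed simp

lemma group_filter_Delta: "group_filter A \<Delta>"
proof (intro group_filter.intro group_filter_axioms.intro A.group_axioms subgroup_Delta)
  fix s t :: 'm
  show "commutator_subgroup A (\<Delta> s) (\<Delta> t) \<subseteq> \<Delta> (s + t)"
    unfolding commutator_subgroup_def
  proof (rule A.generate_subgroup_incl[OF _ subgroup_Delta], clarify)
    fix a b assume a: "a \<in> \<Delta> s" and b: "b \<in> \<Delta> t"
    show "commutator A a b \<in> \<Delta> (s + t)"
      unfolding Delta_iff
    proof (intro conjI allI ballI)
      fix u x assume "x \<in> \<phi> u"
      then show "act_comm x (commutator A a b) \<in> \<phi> (u + (s + t))"
        by (rule act_comm_commutator_filter[OF _ a b]) (metis filter_add filter_closed(2,3))
    qed (use a b in \<open>simp add: Delta_carrier A.commutator_closed\<close>)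
  qed
  show "\<Delta> t \<subseteq> \<Delta> s" if "s \<le> t"
    using filter_antimono[OF add_mono_preorder[OF order_refl that]] by (fastforce simp: Delta_iff)
qed

sublocale D: group_filter A \<Delta> by (rule group_filter_Delta)

section \<open>Operators as derivations\<close>

text \<open>The expansion \<open>[x, a a'] = [x,a'] [x,a] [[x,a],a']\<close> has its main factors in reverse order;
  commutativity of the components restores additivity in the operator.\<close>

lemma filter_pairing_act_comm: "filter_pairing G \<phi> A \<Delta> G \<phi> act_comm"
proof unfold_locales
  fix s t :: 'm and x x' a a' assume st: "s \<noteq> 0" "t \<noteq> 0"
  interpret gr: comm_group "gr G \<phi> (s + t)" by (rule comm_group_gr)
  { assume x: "x \<in> \<phi> s" "x' \<in> \<phi> s" and a: "a \<in> \<Delta> t"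
    note c = act_comm_filter[OF x(1) a] act_comm_filter[OF x(2) a]
    note cc = commutator_filter[OF c(1) x(2)]
    show "bar G \<phi> (s + t) (act_comm (x \<otimes> x') a) =
      bar G \<phi> (s + t) (act_comm x a) \<otimes>\<^bsub>gr G \<phi> (s + t)\<^esub> bar G \<phi> (s + t) (act_comm x' a)"
      using x a c cc filter_add[OF cc] bar_eq_one[OF filter_subset_gr_kernel[OF st(1) cc]]
      by (simp add: act_comm_mult_left Delta_carrier filter_closed bar_mult bar_closed) }
  { assume x: "x \<in> \<phi> s" and a: "a \<in> \<Delta> t" "a' \<in> \<Delta> t"
    note c = act_comm_filter[OF x a(1)] act_comm_filter[OF x a(2)]
    note cc = act_comm_filter[OF c(1) a(2)]
    show "bar G \<phi> (s + t) (act_comm x (a \<otimes>\<^bsub>A\<^esub> a')) =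
      bar G \<phi> (s + t) (act_comm x a) \<otimes>\<^bsub>gr G \<phi> (s + t)\<^esub> bar G \<phi> (s + t) (act_comm x a')"
      using x a c cc filter_add[OF cc] bar_eq_one[OF filter_subset_gr_kernel[OF st(2) cc]]
      by (simp add: act_comm_mult_right Delta_carrier filter_closed bar_mult bar_closed gr.m_comm) }
qed (rule act_comm_filter)

sublocale act: filter_pairing G \<phi> A \<Delta> G \<phi> act_comm by (rule filter_pairing_act_comm)

sublocale Lie: lie_ring LR by (rule lie_ring_filter_lie_ring)

abbreviation (input) "LD \<equiv> filter_lie_ring A \<Delta>"

lemma hbar_action:
  assumes x: "x \<in> \<phi> u" and a: "a \<in> \<Delta> s" and s: "s \<noteq> 0"
  shows "hbar G \<phi> u (\<theta> a x) = hbar G \<phi> u x"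
proof -
  note xa = act_comm_filter[OF x a]
  show ?thesis
    using x a xa hbar_deeper_eq_zero[OF s xa] filter_add[OF xa]
    by (simp add: action_eq Delta_carrier filter_closed hbar_mult hbar_closed)
qed

text \<open>The operator \<open>a\<close> respects commutators, so \<open>[x,y]\<^sup>a = [x p, y q]\<close> with \<open>p = [x,a]\<close> and
  \<open>q = [y,a]\<close>; in the expansion of \<open>[x,y]\<^sup>-\<^sup>1 [x p, y q]\<close> all but two factors are deeper than
  \<open>t + u + s\<close>.\<close>

lemma act_leibniz:
  assumes "f \<in> carrier LR" "g \<in> carrier LR" "v \<in> carrier LD"
  shows "act.pair (f \<otimes>\<^bsub>LR\<^esub> g) v = act.pair f v \<otimes>\<^bsub>LR\<^esub> g \<oplus>\<^bsub>LR\<^esub> f \<otimes>\<^bsub>LR\<^esub> act.pair g v"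
proof (rule triadditive_eqI[OF group_filter_axioms group_filter_axioms group_filter_Delta
      abelian_group_filter_lie_ring _ _ _ assms, where F = "\<lambda>f g v. act.pair (f \<otimes>\<^bsub>LR\<^esub> g) v"])
  show "triadditive LR LR LD LR (\<lambda>f g v. act.pair (f \<otimes>\<^bsub>LR\<^esub> g) v)"
    "triadditive LR LR LD LR (\<lambda>f g v. act.pair f v \<otimes>\<^bsub>LR\<^esub> g \<oplus>\<^bsub>LR\<^esub> f \<otimes>\<^bsub>LR\<^esub> act.pair g v)"
    by (simp_all add: triadditive_def bracket_closed bracket_add_left bracket_add_right
        act.pair_closed act.pair_add_left act.pair_add_right L.add_interchange)
  fix t u s x y a
  assume t: "t \<noteq> 0" and u: "u \<noteq> 0" and s: "s \<noteq> 0" and x: "x \<in> \<phi> t" and y: "y \<in> \<phi> u" and a: "a \<in> \<Delta> s"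
  let ?d = "t + u + s"
  define p q c where "p = act_comm x a" and "q = act_comm y a" and "c = commutator G x y"
  have p: "p \<in> \<phi> (t + s)" and q: "q \<in> \<phi> (u + s)" and c: "c \<in> \<phi> (t + u)"
    using x y a by (simp_all add: p_def q_def c_def act_comm_filter commutator_filter)
  have q': "q \<in> \<phi> u" and c': "c \<in> \<phi> t" and xp: "x \<otimes> p \<in> \<phi> t"
    using filter_add[OF q] filter_add[OF c] filter_add[OF p] x by (simp_all add: filter_closed)
  note proper = proper_degree_nonzero[OF t] proper_degree_nonzero[OF u] proper_degree_nonzero[OF s]
  have xpq: "commutator G (x \<otimes> p) q \<in> \<phi> ?d" and py: "commutator G p y \<in> \<phi> ?d"
    and cq: "commutator G c q \<in> \<phi> (?d + u)" and cp: "commutator G c p \<in> \<phi> (?d + t)"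
    using commutator_filter[OF xp q] commutator_filter[OF p y] commutator_filter[OF c q]
      commutator_filter[OF c p]
    by (simp_all add: ac_simps)
  have eq: "act_comm c a = (inv c \<otimes> commutator G (x \<otimes> p) q \<otimes> c) \<otimes>
      (commutator G c q \<otimes> ((inv q \<otimes> commutator G c p \<otimes> q) \<otimes> (inv q \<otimes> commutator G p y \<otimes> q)))"
    using act_comm_commutator_left[of a x y] commutator_perturbed[of x y p q] x y a p q
    by (simp add: filter_closed Delta_carrier p_def[symmetric] q_def[symmetric] c_def[symmetric])
  have "hbar G \<phi> ?d (act_comm c a) = hbar G \<phi> ?d (commutator G (x \<otimes> p) q) \<oplus>\<^bsub>LR\<^esub>
      hbar G \<phi> ?d (commutator G p y)"
    unfolding eq
    using xpq py filter_add[OF cq] filter_add[OF cp] q' c'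
    by (simp add: hbar_mult filter_closed conj_filter hbar_conj[OF _ c' t] hbar_conj[OF _ q' u]
        hbar_deeper_eq_zero[OF u cq] hbar_deeper_eq_zero[OF t cp] hbar_closed)
  also have "hbar G \<phi> ?d (commutator G (x \<otimes> p) q) = hbar G \<phi> t x \<otimes>\<^bsub>LR\<^esub> hbar G \<phi> (u + s) q"
    using bracket_hbar[of t "u + s" "x \<otimes> p" q] proper xp q x filter_add[OF p] hbar_deeper_eq_zero[OF s p]
    by (simp add: proper_degree_add hbar_mult hbar_closed add.assoc)
  also have "hbar G \<phi> ?d (commutator G p y) = hbar G \<phi> (t + s) p \<otimes>\<^bsub>LR\<^esub> hbar G \<phi> u y"
    using bracket_hbar[of "t + s" u p y] proper p y
    by (simp add: proper_degree_add ac_simps)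
  finally have "hbar G \<phi> ?d (act_comm c a) =
      hbar G \<phi> (t + s) p \<otimes>\<^bsub>LR\<^esub> hbar G \<phi> u y \<oplus>\<^bsub>LR\<^esub> hbar G \<phi> t x \<otimes>\<^bsub>LR\<^esub> hbar G \<phi> (u + s) q"
    using x y p q by (simp add: L.a_comm hbar_closed bracket_closed)
  then show "act.pair (hbar G \<phi> t x \<otimes>\<^bsub>LR\<^esub> hbar G \<phi> u y) (hbar A \<Delta> s a) =
    act.pair (hbar G \<phi> t x) (hbar A \<Delta> s a) \<otimes>\<^bsub>LR\<^esub> hbar G \<phi> u y \<oplus>\<^bsub>LR\<^esub>
    hbar G \<phi> t x \<otimes>\<^bsub>LR\<^esub> act.pair (hbar G \<phi> u y) (hbar A \<Delta> s a)"
    using proper x y a c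
    by (simp add: bracket_hbar act.pair_hbar proper_degree_add c_def p_def q_def)
qed

text \<open>As \<open>a\<close> and \<open>b\<close> have nonzero degree, \<open>y = x\<^bsup>inv(ba)\<^esup>\<close> and \<open>x\<close> have the same class, so the
  expansion of \<open>[x,[a,b]]\<close> can be read at \<open>x\<close>.\<close>

lemma act_bracket:
  assumes "f \<in> carrier LR" "v \<in> carrier LD" "w \<in> carrier LD"
  shows "act.pair f (v \<otimes>\<^bsub>LD\<^esub> w) = act.pair (act.pair f v) w \<ominus>\<^bsub>LR\<^esub> act.pair (act.pair f w) v"
proof (rule triadditive_eqI[OF group_filter_axioms group_filter_Delta group_filter_Delta
      abelian_group_filter_lie_ring _ _ _ assms, where F = "\<lambda>f v w. act.pair f (v \<otimes>\<^bsub>LD\<^esub> w)"])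
  show "triadditive LR LD LD LR (\<lambda>f v w. act.pair f (v \<otimes>\<^bsub>LD\<^esub> w))"
    "triadditive LR LD LD LR (\<lambda>f v w. act.pair (act.pair f v) w \<ominus>\<^bsub>LR\<^esub> act.pair (act.pair f w) v)"
    by (simp_all add: triadditive_def D.bracket_closed D.bracket_add_left D.bracket_add_right
        act.pair_closed act.pair_add_left act.pair_add_right L.minus_eq L.minus_add L.add_interchange)
  fix u s t x a b
  assume u: "u \<noteq> 0" and s: "s \<noteq> 0" and t: "t \<noteq> 0" and x: "x \<in> \<phi> u" and a: "a \<in> \<Delta> s" and b: "b \<in> \<Delta> t"
  let ?d = "u + (s + t)"
  note proper = proper_degree_nonzero[OF t] proper_degree_nonzero[OF u] proper_degree_nonzero[OF s]
  note ab = Delta_carrier[OF a] Delta_carrier[OF b]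
  obtain y where y_def: "y = \<theta> (inv\<^bsub>A\<^esub> (b \<otimes>\<^bsub>A\<^esub> a)) x" and y: "y \<in> \<phi> u"
    and ba: "act_comm (act_comm y b) a \<in> \<phi> ?d"
    and c: "commutator G (act_comm y b) (act_comm y a) \<in> \<phi> (?d + u)"
    and ab': "act_comm (act_comm y a) b \<in> \<phi> ?d"
    and eq: "act_comm x (commutator A a b) = inv (act_comm (act_comm y b) a) \<otimes>
      (commutator G (act_comm y b) (act_comm y a) \<otimes> act_comm (act_comm y a) b)"
    using act_comm_commutator_filter[OF x a b] by metis
  have yx: "hbar G \<phi> u y = hbar G \<phi> u x"
    unfolding y_def using ab x
    by (simp add: A.inv_mult_group action_comp filter_closed action_filter
        hbar_action[OF _ D.filter_closed(3)[OF b] t] hbar_action[OF _ D.filter_closed(3)[OF a] s])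
  have "hbar G \<phi> ?d (act_comm x (commutator A a b)) =
      hbar G \<phi> ?d (act_comm (act_comm y a) b) \<ominus>\<^bsub>LR\<^esub> hbar G \<phi> ?d (act_comm (act_comm y b) a)"
    unfolding eq using ba ab' filter_add[OF c] hbar_deeper_eq_zero[OF u c]
    by (simp add: hbar_mult filter_closed hbar_inv hbar_closed L.minus_eq L.a_comm)
  also have "hbar G \<phi> ?d (act_comm (act_comm y a) b) =
      act.pair (act.pair (hbar G \<phi> u x) (hbar A \<Delta> s a)) (hbar A \<Delta> t b)"
    using proper y a b act_comm_filter[OF y a]
    by (simp add: act.pair_hbar proper_degree_add add.assoc flip: yx)
  also have "hbar G \<phi> ?d (act_comm (act_comm y b) a) =
      act.pair (act.pair (hbar G \<phi> u x) (hbar A \<Delta> t b)) (hbar A \<Delta> s a)"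
    using proper y a b act_comm_filter[OF y b]
    by (simp add: act.pair_hbar proper_degree_add ac_simps flip: yx)
  also have "hbar G \<phi> ?d (act_comm x (commutator A a b)) =
      act.pair (hbar G \<phi> u x) (hbar A \<Delta> s a \<otimes>\<^bsub>LD\<^esub> hbar A \<Delta> t b)"
    using proper x a b
    by (simp add: D.bracket_hbar act.pair_hbar proper_degree_add D.commutator_filter)
  finally show "act.pair (hbar G \<phi> u x) (hbar A \<Delta> s a \<otimes>\<^bsub>LD\<^esub> hbar A \<Delta> t b) =
    act.pair (act.pair (hbar G \<phi> u x) (hbar A \<Delta> s a)) (hbar A \<Delta> t b) \<ominus>\<^bsub>LR\<^esub>
    act.pair (act.pair (hbar G \<phi> u x) (hbar A \<Delta> t b)) (hbar A \<Delta> s a)" .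
qed

definition der_of :: "('m \<Rightarrow> 'a set) \<Rightarrow> ('m \<Rightarrow> 'g set) \<Rightarrow> ('m \<Rightarrow> 'g set)" where
  "der_of v = (\<lambda>f\<in>carrier LR. act.pair f v)"

lemma derivation_der_of: "v \<in> carrier LD \<Longrightarrow> derivation LR (der_of v)"
  by (rule Lie.derivationI)
     (simp_all add: der_of_def act.pair_closed act.pair_add_left bracket_closed act_leibniz)

lemma lie_ring_hom_der_of: "lie_ring_hom LD (Der LR) der_of"
proof (intro lie_ring_hom.intro lie_ring_hom_axioms.intro D.lie_ring_filter_lie_ring Lie.lie_ring_Der)
  fix v w assume v: "v \<in> carrier LD" and w: "w \<in> carrier LD"
  show "der_of v \<in> carrier (Der LR)"
    using v by (simp add: Lie.Der_simps derivation_der_of)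
  show "der_of (v \<oplus>\<^bsub>LD\<^esub> w) = der_of v \<oplus>\<^bsub>Der LR\<^esub> der_of w"
    using v w by (auto simp: Lie.Der_simps der_of_def act.pair_add_right intro!: restrict_ext)
  show "der_of (v \<otimes>\<^bsub>LD\<^esub> w) = der_of v \<otimes>\<^bsub>Der LR\<^esub> der_of w"
    using v w by (auto simp: Lie.Der_simps der_of_def act_bracket act.pair_closed intro!: restrict_ext)
qed

lemma graded_der_of: "graded_into_Der A \<Delta> G \<phi> der_of"
  unfolding graded_into_Der_def
proof (intro allI ballI)
  fix s u v f assume v: "v \<in> homogeneous A \<Delta> s" and f: "f \<in> homogeneous G \<phi> u"
  have "f \<in> carrier LR" using f by (auto simp: homogeneous_eq hbar_closed)
  then show "der_of v f \<in> homogeneous G \<phi> (s + u)"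
    using act.pair_homogeneous[OF f v] by (simp add: der_of_def add.commute)
qed

lemma commutator_derivation_der_of:
  assumes s: "s \<noteq> 0" and a: "a \<in> \<Delta> s"
  shows "is_commutator_derivation G \<theta> \<phi> s a (der_of (hbar A \<Delta> s a))"
  unfolding is_commutator_derivation_def
  using derivation_der_of[OF D.hbar_closed[OF a]] s a
  by (auto simp: der_of_def hbar_closed act.pair_hbar proper_degree_nonzero add.commute)

text \<open>The prescribed values are those on the additive generators of nonzero degree.\<close>

lemma commutator_derivation_unique:
  assumes "is_commutator_derivation G \<theta> \<phi> s a D" "is_commutator_derivation G \<theta> \<phi> s a E"
  shows "D = E"
proof -
  have D: "derivation LR D" and E: "derivation LR E"
    using assms by (auto simp: is_commutator_derivation_def)
  show ?thesis
  proof (rule Lie.derivation_eqI[OF D E])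
    fix f assume "f \<in> carrier LR"
    then show "D f = E f"
      by (rule additive_map_eqI[OF abelian_group_filter_lie_ring, rotated -1])
         (use assms D E in \<open>auto simp: Lie.derivationD is_commutator_derivation_def\<close>)
  qed
qed

end

section \<open>The filter of operators and its Lie ring\<close>

theorem theorem4:
  fixes G :: "('g, 'x) monoid_scheme"
    and A :: "('a, 'y) monoid_scheme"
    and \<theta> :: "'a \<Rightarrow> 'g \<Rightarrow> 'g"
    and \<phi> :: "'m::preordered_comm_monoid_add \<Rightarrow> 'g set"
  assumes "group G"
    and "group A"
    and "\<theta> \<in> hom A (right_AutoGroup G)"
    and "group_filter G \<phi>"
    and "\<And>s. invariant_under A \<theta> (\<phi> s)"
  shows "group_filter A (filter_Delta A G \<theta> \<phi>) \<and>
    (\<forall>s a. s \<noteq> 0 \<longrightarrow> a \<in> filter_Delta A G \<theta> \<phi> s \<longrightarrow>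
      (\<exists>!D. is_commutator_derivation G \<theta> \<phi> s a D)) \<and>
    (\<exists>h. lie_ring_hom (filter_lie_ring A (filter_Delta A G \<theta> \<phi>)) (Der (filter_lie_ring G \<phi>)) h \<and>
      graded_into_Der A (filter_Delta A G \<theta> \<phi>) G \<phi> h \<and>
      (\<forall>s a. s \<noteq> 0 \<longrightarrow> a \<in> filter_Delta A G \<theta> \<phi> s \<longrightarrow>
        is_commutator_derivation G \<theta> \<phi> s a (h (hbar A (filter_Delta A G \<theta> \<phi>) s a))))"
proof -
  interpret filter_action G \<phi> A \<theta>
    using assms by (simp add: filter_action_def filter_action_axioms_def)
  show ?thesis
    using group_filter_Delta lie_ring_hom_der_of graded_der_of commutator_derivation_der_of
      commutator_derivation_unique
    by blast
qed

end
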